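(* Let $I=[0,1]$ and $\varepsilon>0$, let $f:I\to I$ be a continuous densely $\varepsilon$-chaotic map and let $\overline f:\mathcal K(I)\to\mathcal K(I)$ be the map induced by $f$. Then $\overline f$ is densely $\varepsilon$-chaotic.
   Context: For a compact metric space $(X,d)$, $\mathcal K(X)$ denotes the set of all non-empty compact subsets of $X$ with the Hausdorff metric $d_H$ (a compact metric space). A continuous map $f:X\to X$ induces the continuous map $\overline f:\mathcal K(X)\to\mathcal K(X)$, $\overline f(K)=f(K)=\{f(x): x\in K\}$. For a continuous map $g:Y\to Y$ of a compact metric space $(Y,\rho)$ and $\varepsilon>0$, let $C(g,\varepsilon)$ be the set of pairs $(x,y)\in Y^2$ with $\liminf_{n\to\infty}\rho(g^n(x),g^n(y))=0$ and $\limsup_{n\to\infty}\rho(g^n(x),g^n(y))>\varepsilon$. The map $g$ is densely $\varepsilon$-chaotic if $C(g,\varepsilon)$ is dense in $Y^2$. For $\overline f$ this is applied with $Y=\mathcal K(X)$, $\rho=d_H$. The interval $I$ carries the metric $|x-y|$. *)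

theory Defs
  imports "HOL-Analysis.Analysis"
begin

section \<open>The hyperspace of non-empty compact sets\<close>

definition hyperspace :: "'a metric \<Rightarrow> 'a set set" where
  "hyperspace m = {K. K \<noteq> {} \<and> compactin (mtopology_of m) K}"

text \<open>A \<^locale>\<open>Metric_space\<close> must have a symmetric and non-negative distance also outside
  its carrier, where the suprema of reals below need not be meaningful; hence the default value 0.\<close>

definition hausdorff_dist :: "'a metric \<Rightarrow> 'a set \<Rightarrow> 'a set \<Rightarrow> real" where
  "hausdorff_dist m A B =
     (if A \<in> hyperspace m \<and> B \<in> hyperspace m
      then max (SUP a\<in>A. INF b\<in>B. mdist m a b) (SUP b\<in>B. INF a\<in>A. mdist m a b)
      else 0)"

definition hyperspace_metric :: "'a metric \<Rightarrow> 'a set metric" where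
  "hyperspace_metric m = metric (hyperspace m, hausdorff_dist m)"

text \<open>The argument of \<^const>\<open>metric\<close> above is a metric space, so that \<^const>\<open>hyperspace_metric\<close>
  has the intended carrier and distance.\<close>

context
  fixes m :: "'a metric"
begin

lemma hyperspaceD:
  assumes "A \<in> hyperspace m"
  shows "A \<noteq> {}" "A \<subseteq> mspace m" "compactin (mtopology_of m) A" "closedin (mtopology_of m) A"
proof -
  interpret Metric_space "mspace m" "mdist m" by simp
  show "A \<noteq> {}" and c: "compactin (mtopology_of m) A"
    using assms by (auto simp: hyperspace_def)
  show "A \<subseteq> mspace m"
    using compactin_subset_topspace [OF c] by simp
  show "closedin (mtopology_of m) A"
    using c by (metis Hausdorff_space_mtopology compactin_imp_closedin mtopology_of_def)
qed

lemma hausdorff_bdd_below: "bdd_below ((\<lambda>b. mdist m a b) ` B)"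
  by (rule bdd_belowI [of _ 0]) auto

lemma hausdorff_inf_le: "b \<in> B \<Longrightarrow> (INF b\<in>B. mdist m a b) \<le> mdist m a b"
  by (rule cINF_lower [OF hausdorff_bdd_below])

lemma hausdorff_inf_nonneg: "B \<noteq> {} \<Longrightarrow> 0 \<le> (INF b\<in>B. mdist m a b)"
  by (rule cINF_greatest) auto

lemma hausdorff_bdd_above:
  assumes "A \<in> hyperspace m" "B \<in> hyperspace m"
  shows "bdd_above ((\<lambda>a. INF b\<in>B. mdist m a b) ` A)"
proof -
  interpret Metric_space "mspace m" "mdist m" by simp
  obtain b where b: "b \<in> B" "b \<in> mspace m"
    using hyperspaceD [OF assms(2)] by blast
  have "mbounded A"
    using hyperspaceD(3) [OF assms(1)] by (simp add: compactin_imp_mbounded mtopology_of_def)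
  then obtain C where C: "\<And>a. a \<in> A \<Longrightarrow> mdist m a b \<le> C"
    using mbounded_insert [of b A] b(2) unfolding mbounded_alt by (metis insert_iff)
  show ?thesis
    by (rule bdd_aboveI2 [of _ _ C]) (use C hausdorff_inf_le [OF b(1)] order_trans in blast)
qed

lemma hausdorff_excess_le:
  assumes "A \<in> hyperspace m" "B \<in> hyperspace m" "a \<in> A"
  shows "(INF b\<in>B. mdist m a b) \<le> (SUP a\<in>A. INF b\<in>B. mdist m a b)"
  by (rule cSUP_upper [OF assms(3) hausdorff_bdd_above [OF assms(1,2)]])

lemma hausdorff_excess_nonneg:
  assumes "A \<in> hyperspace m" "B \<in> hyperspace m"
  shows "0 \<le> (SUP a\<in>A. INF b\<in>B. mdist m a b)"
proof -
  obtain a where a: "a \<in> A" using hyperspaceD(1) [OF assms(1)] by blast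
  show ?thesis
    using hausdorff_excess_le [OF assms a] hausdorff_inf_nonneg [OF hyperspaceD(1) [OF assms(2)], of a]
    by linarith
qed

lemma hausdorff_excess_zero:
  assumes A: "A \<in> hyperspace m" and B: "B \<in> hyperspace m"
    and z: "(SUP a\<in>A. INF b\<in>B. mdist m a b) \<le> 0"
  shows "A \<subseteq> B"
proof
  interpret Metric_space "mspace m" "mdist m" by simp
  fix a assume a: "a \<in> A"
  then have am: "a \<in> mspace m" using hyperspaceD(2) [OF A] by blast
  have le: "(INF b\<in>B. mdist m a b) \<le> 0"
    using hausdorff_excess_le [OF A B a] z by linarith
  have "a \<in> mtopology closure_of B"
    unfolding metric_closure_of
  proof (clarsimp simp: am)
    fix r :: real assume "0 < r"
    then have "(INF b\<in>B. mdist m a b) < r" using le by linarith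
    then obtain b where "b \<in> B" "mdist m a b < r"
      using cINF_less_iff [OF hyperspaceD(1) [OF B] hausdorff_bdd_below] by blast
    then show "\<exists>y\<in>B. y \<in> mspace m \<and> mdist m a y < r"
      using hyperspaceD(2) [OF B] by blast
  qed
  then show "a \<in> B"
    using closure_of_closedin hyperspaceD(4) [OF B] by (metis mtopology_of_def)
qed

lemma hausdorff_excess_triangle:
  assumes A: "A \<in> hyperspace m" and B: "B \<in> hyperspace m" and C: "C \<in> hyperspace m"
  shows "(SUP a\<in>A. INF c\<in>C. mdist m a c)
           \<le> (SUP a\<in>A. INF b\<in>B. mdist m a b) + (SUP b\<in>B. INF c\<in>C. mdist m b c)"
    (is "?AC \<le> ?AB + ?BC")
proof (rule cSUP_least [OF hyperspaceD(1) [OF A]])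
  interpret Metric_space "mspace m" "mdist m" by simp
  fix a assume a: "a \<in> A"
  have "(INF c\<in>C. mdist m a c) - ?BC \<le> mdist m a b" if b: "b \<in> B" for b
  proof -
    have "(INF c\<in>C. mdist m a c) - mdist m a b \<le> (INF c\<in>C. mdist m b c)"
    proof (rule cINF_greatest [OF hyperspaceD(1) [OF C]])
      fix c assume c: "c \<in> C"
      have "mdist m a c \<le> mdist m a b + mdist m b c"
        using a b c hyperspaceD(2) [OF A] hyperspaceD(2) [OF B] hyperspaceD(2) [OF C]
        by (intro triangle) auto
      then show "(INF c\<in>C. mdist m a c) - mdist m a b \<le> mdist m b c"
        using hausdorff_inf_le [OF c, of a] by linarith
    qed
    then show ?thesis using hausdorff_excess_le [OF B C b] by linarith
  qed
  then have "(INF c\<in>C. mdist m a c) - ?BC \<le> (INF b\<in>B. mdist m a b)"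
    by (intro cINF_greatest [OF hyperspaceD(1) [OF B]])
  then show "(INF c\<in>C. mdist m a c) \<le> ?AB + ?BC"
    using hausdorff_excess_le [OF A B a] by linarith
qed

lemma Metric_space_hyperspace: "Metric_space (hyperspace m) (hausdorff_dist m)"
proof
  have comm: "mdist m x y = mdist m y x" for x y by (simp add: mdist_commute)
  have dist_eq: "hausdorff_dist m A B =
      max (SUP a\<in>A. INF b\<in>B. mdist m a b) (SUP b\<in>B. INF a\<in>A. mdist m b a)"
    if "A \<in> hyperspace m" "B \<in> hyperspace m" for A B
    using that by (simp add: hausdorff_dist_def comm)
  show "0 \<le> hausdorff_dist m A B" for A B
    using hausdorff_excess_nonneg [of A B] by (auto simp: hausdorff_dist_def le_max_iff_disj)
  show "hausdorff_dist m A B = hausdorff_dist m B A" for A B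
    by (cases "A \<in> hyperspace m \<and> B \<in> hyperspace m")
      (simp add: dist_eq max.commute, auto simp: hausdorff_dist_def)
  show "hausdorff_dist m A B = 0 \<longleftrightarrow> A = B"
    if A: "A \<in> hyperspace m" and B: "B \<in> hyperspace m" for A B
  proof
    assume "hausdorff_dist m A B = 0"
    then have "(SUP a\<in>A. INF b\<in>B. mdist m a b) \<le> 0" "(SUP b\<in>B. INF a\<in>A. mdist m b a) \<le> 0"
      unfolding dist_eq [OF A B] by linarith+
    then show "A = B" using hausdorff_excess_zero A B by blast
  next
    assume "A = B"
    have "(SUP a\<in>A. INF b\<in>A. mdist m a b) \<le> 0"
    proof (rule cSUP_least [OF hyperspaceD(1) [OF A]])
      fix a assume "a \<in> A"
      then have "mdist m a a = 0" using hyperspaceD(2) [OF A] by (simp add: subsetD)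
      then show "(INF b\<in>A. mdist m a b) \<le> 0"
        using hausdorff_inf_le [OF \<open>a \<in> A\<close>, of a] by linarith
    qed
    then show "hausdorff_dist m A B = 0"
      using hausdorff_excess_nonneg [OF A A] A \<open>A = B\<close> by (simp add: dist_eq)
  qed
  show "hausdorff_dist m A C \<le> hausdorff_dist m A B + hausdorff_dist m B C"
    if "A \<in> hyperspace m" "B \<in> hyperspace m" "C \<in> hyperspace m" for A B C
    using hausdorff_excess_triangle [of A B C] hausdorff_excess_triangle [of C B A] that
    unfolding dist_eq [OF that(1,2)] dist_eq [OF that(2,3)] dist_eq [OF that(1,3)] by linarith
qed

lemma mspace_hyperspace_metric [simp]: "mspace (hyperspace_metric m) = hyperspace m"
  by (simp add: hyperspace_metric_def Metric_space.mspace_metric Metric_space_hyperspace)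

lemma mdist_hyperspace_metric [simp]: "mdist (hyperspace_metric m) = hausdorff_dist m"
  by (simp add: hyperspace_metric_def Metric_space.mdist_metric Metric_space_hyperspace)

end

section \<open>Dense chaos\<close>

text \<open>Limits inferior and superior are taken in the complete lattice \<^typ>\<open>ereal\<close>.\<close>

definition chaotic_pairs :: "'a metric \<Rightarrow> ('a \<Rightarrow> 'a) \<Rightarrow> real \<Rightarrow> ('a \<times> 'a) set" where
  "chaotic_pairs m g \<epsilon> =
     {(x, y) \<in> mspace m \<times> mspace m.
        liminf (\<lambda>n. ereal (mdist m ((g ^^ n) x) ((g ^^ n) y))) = 0 \<and>
        limsup (\<lambda>n. ereal (mdist m ((g ^^ n) x) ((g ^^ n) y))) > ereal \<epsilon>}"

definition densely_chaotic :: "'a metric \<Rightarrow> ('a \<Rightarrow> 'a) \<Rightarrow> real \<Rightarrow> bool" where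
  "densely_chaotic m g \<epsilon> \<longleftrightarrow>
     prod_topology (mtopology_of m) (mtopology_of m) closure_of chaotic_pairs m g \<epsilon>
       = mspace m \<times> mspace m"

definition unit_interval_metric :: "real metric" where
  "unit_interval_metric = submetric euclidean_metric {0..1}"

lemma mspace_unit_interval_metric [simp]: "mspace unit_interval_metric = {0..1}"
  and mdist_unit_interval_metric [simp]: "mdist unit_interval_metric x y = \<bar>x - y\<bar>"
  by (simp_all add: unit_interval_metric_def dist_real_def)

end

theory Submission
  imports Defs
begin

text \<open>
  Call a non-degenerate subinterval of \<open>I\<close> fat. Chaotic pairs exist in every product of two fat sets, so
  images of fat sets are fat. The key fact is that among any three fat sets two have, at some time, images
  that overlap in a fat set. To see this, one first shows that the orbit of a fat set contains a periodic
  point, which makes the order of three never overlapping sets constant along a suitable iterate \<open>g\<close>. As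
  the outer sets contain a chaotic pair, some image of an outer set meets the middle one in a fat set \<open>G\<close>,
  and then the sets \<open>g\<^sup>k(G)\<close> are monotonically ordered along an arithmetic progression of times \<open>k\<close>, which
  is incompatible with the existence of a chaotic pair in \<open>G\<close>.

  Consequently, for finitely many small intervals around nets of two compact sets, there are a time \<open>N\<close> and
  at most two fat sets \<open>U\<close>, \<open>V\<close>, equal or never overlapping, such that every \<open>N\<close>-th image contains \<open>U\<close> or \<open>V\<close>.
  One can therefore approximate the compact sets by finite sets whose \<open>N\<close>-th images are \<open>{x} \<union> Z\<close> and \<open>{y} \<union> Z\<close>
  with \<open>(x, y)\<close> chaotic and \<open>Z\<close> at most a single point whose orbit never enters the open interval between the
  orbits of \<open>x\<close> and \<open>y\<close>. From time \<open>N\<close> on, their Hausdorff distance is that of the orbits of \<open>x\<close> and \<open>y\<close>.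
\<close>

section \<open>Chaotic sequences and pairs\<close>

text \<open>The number \<open>e\<close> encodes the strict inequality for the limit superior: values
  above \<open>\<epsilon>\<close> infinitely often would only show that it is at least
  \<open>\<epsilon>\<close>.\<close>

definition chaotic_seq :: "real \<Rightarrow> (nat \<Rightarrow> real) \<Rightarrow> bool" where
  "chaotic_seq \<epsilon> d \<longleftrightarrow> (\<forall>\<delta>>0. \<forall>N. \<exists>n\<ge>N. d n < \<delta>) \<and> (\<exists>e>\<epsilon>. \<forall>N. \<exists>n\<ge>N. d n > e)"

lemma chaotic_seq_iff_liminf_limsup:
  assumes "\<And>n. 0 \<le> d n"
  shows "liminf (\<lambda>n. ereal (d n)) = 0 \<and> limsup (\<lambda>n. ereal (d n)) > ereal \<epsilon> \<longleftrightarrow> chaotic_seq \<epsilon> d"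
proof -
  have "liminf (\<lambda>n. ereal (d n)) = 0 \<longleftrightarrow> liminf (\<lambda>n. ereal (d n)) \<le> 0"
    using Liminf_bounded [of 0 "\<lambda>n. ereal (d n)" sequentially] assms by auto
  also have "\<dots> \<longleftrightarrow> (\<forall>\<delta>>0. \<forall>N. \<exists>n\<ge>N. d n < \<delta>)"
  proof
    assume le: "liminf (\<lambda>n. ereal (d n)) \<le> 0"
    show "\<forall>\<delta>>0. \<forall>N. \<exists>n\<ge>N. d n < \<delta>"
    proof (rule ccontr)
      assume "\<not> ?thesis"
      then obtain \<delta> N where "\<delta> > 0" "\<And>n. n \<ge> N \<Longrightarrow> d n \<ge> \<delta>" by (auto simp: not_less)
      then have "ereal \<delta> \<le> liminf (\<lambda>n. ereal (d n))"
        by (intro Liminf_bounded) (auto simp: eventually_sequentially)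
      with le \<open>\<delta> > 0\<close> show False by (metis ereal_less(2) leD order_trans)
    qed
  next
    assume small: "\<forall>\<delta>>0. \<forall>N. \<exists>n\<ge>N. d n < \<delta>"
    show "liminf (\<lambda>n. ereal (d n)) \<le> 0"
    proof (rule ccontr)
      assume "\<not> ?thesis"
      then obtain \<delta> where "0 < ereal \<delta>" and \<delta>: "ereal \<delta> < liminf (\<lambda>n. ereal (d n))"
        by (metis ereal_dense2 not_le)
      then obtain N where "\<And>n. n \<ge> N \<Longrightarrow> ereal \<delta> < ereal (d n)"
        using less_LiminfD [OF \<delta>] by (auto simp: eventually_sequentially)
      with small \<open>0 < ereal \<delta>\<close> show False by (meson ereal_less(2) less_ereal.simps(1) less_asym)
    qed
  qed
  finally have inf: "liminf (\<lambda>n. ereal (d n)) = 0 \<longleftrightarrow> (\<forall>\<delta>>0. \<forall>N. \<exists>n\<ge>N. d n < \<delta>)" .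
  have sup: "limsup (\<lambda>n. ereal (d n)) > ereal \<epsilon> \<longleftrightarrow> (\<exists>e>\<epsilon>. \<forall>N. \<exists>n\<ge>N. d n > e)"
  proof
    assume "limsup (\<lambda>n. ereal (d n)) > ereal \<epsilon>"
    then obtain e where e: "ereal \<epsilon> < ereal e" "ereal e < limsup (\<lambda>n. ereal (d n))"
      using ereal_dense2 by blast
    have "\<exists>n\<ge>N. d n > e" for N
    proof (rule ccontr)
      assume "\<not> ?thesis"
      then have "limsup (\<lambda>n. ereal (d n)) \<le> ereal e"
        by (intro Limsup_bounded) (auto simp: eventually_sequentially not_less)
      with e show False by simp
    qed
    with e show "\<exists>e>\<epsilon>. \<forall>N. \<exists>n\<ge>N. d n > e" by auto
  next
    assume "\<exists>e>\<epsilon>. \<forall>N. \<exists>n\<ge>N. d n > e"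
    then obtain e where e: "e > \<epsilon>" "\<And>N. \<exists>n\<ge>N. d n > e" by blast
    show "limsup (\<lambda>n. ereal (d n)) > ereal \<epsilon>"
    proof (rule ccontr)
      assume "\<not> ?thesis"
      then have "limsup (\<lambda>n. ereal (d n)) < ereal e"
        using e(1) by (metis less_ereal.simps(1) not_less order_le_less_trans)
      then obtain N where "\<And>n. n \<ge> N \<Longrightarrow> ereal (d n) < ereal e"
        using Limsup_lessD by (fastforce simp: eventually_sequentially)
      with e(2) [of N] show False by (metis less_asym ereal_less_eq(3) not_less)
    qed
  qed
  show ?thesis unfolding chaotic_seq_def inf sup by blast
qed

lemma chaotic_seq_shift:
  assumes "chaotic_seq \<epsilon> (\<lambda>n. d (n + N))"
  shows "chaotic_seq \<epsilon> d"
proof -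
  have shift: "\<exists>n\<ge>M. P (d n)" if "\<forall>M. \<exists>n\<ge>M. P (d (n + N))" for P M
    using that by (meson le_add1 order_trans)
  show ?thesis
    using assms shift [of "\<lambda>t. t < _"] shift [of "\<lambda>t. _ < t"] unfolding chaotic_seq_def by blast
qed

section \<open>Fat sets\<close>

definition fat :: "real set \<Rightarrow> bool" where
  "fat U \<longleftrightarrow> connected U \<and> U \<subseteq> {0..1} \<and> (\<exists>x\<in>U. \<exists>y\<in>U. x < y)"

text \<open>The weak inequality lets intervals with a common end point count as ordered, as the
  trichotomy below demands.\<close>

definition precedes :: "real set \<Rightarrow> real set \<Rightarrow> bool" where
  "precedes U V \<longleftrightarrow> (\<forall>x\<in>U. \<forall>y\<in>V. x \<le> y)"

lemma precedesD: "precedes U V \<Longrightarrow> x \<in> U \<Longrightarrow> y \<in> V \<Longrightarrow> x \<le> y"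
  by (auto simp: precedes_def)

lemma precedes_mono: "precedes U V \<Longrightarrow> U' \<subseteq> U \<Longrightarrow> V' \<subseteq> V \<Longrightarrow> precedes U' V'"
  by (auto simp: precedes_def)

lemma fat_Icc_subset: "fat U \<Longrightarrow> a \<in> U \<Longrightarrow> b \<in> U \<Longrightarrow> {a..b} \<subseteq> U"
  by (simp add: fat_def connected_contains_Icc)

lemma fat_Icc:
  assumes "0 \<le> a" "a < b" "b \<le> 1"
  shows "fat {a..b}"
proof -
  have "a \<in> {a..b}" "b \<in> {a..b}" using assms by auto
  then have "\<exists>x\<in>{a..b}. \<exists>y\<in>{a..b}. x < y" using assms(2) by blast
  with assms show ?thesis by (simp add: fat_def)
qed

lemma fat_Icc_sub: "fat U \<Longrightarrow> a \<in> U \<Longrightarrow> b \<in> U \<Longrightarrow> a < b \<Longrightarrow> fat {a..b}"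
  by (rule fat_Icc) (auto simp: fat_def)

lemma fat_obtain_neq:
  assumes "fat U" obtains a where "a \<in> U" "a \<noteq> q"
proof -
  obtain x y where "x \<in> U" "y \<in> U" "x < y" using assms by (auto simp: fat_def)
  then show thesis using that by (cases "x = q") auto
qed

lemma fat_nonempty: "fat U \<Longrightarrow> U \<noteq> {}"
  by (auto simp: fat_def)

lemma fat_Int:
  assumes "fat U" "fat V" "x \<in> U" "x \<in> V" "y \<in> U" "y \<in> V" "x < y"
  shows "fat (U \<inter> V)"
proof -
  have "connected (U \<inter> V)"
    using assms(1,2) by (simp add: fat_def is_interval_Int flip: is_interval_connected_1)
  with assms show ?thesis by (auto simp: fat_def)
qed

text \<open>If both orders fail, there are \<open>y < x\<close> and \<open>x' < y'\<close> with
  \<open>x\<close>, \<open>x'\<close> in \<open>U\<close> and \<open>y\<close>, \<open>y'\<close> in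
  \<open>V\<close>. Combined with two distinct points of each set they give \<open>a < b\<close> in
  \<open>U\<close> and \<open>c < d\<close> in \<open>V\<close> with \<open>a < d\<close> and
  \<open>c < b\<close>, so the interval from \<open>max a c\<close> to \<open>min b d\<close> is a
  non-degenerate common part.\<close>

lemma fat_trichotomy:
  assumes U: "fat U" and V: "fat V"
  shows "fat (U \<inter> V) \<or> precedes U V \<or> precedes V U"
proof (rule ccontr)
  assume neg: "\<not> ?thesis"
  obtain x y x' y' where xy: "x \<in> U" "y \<in> V" "y < x" "x' \<in> U" "y' \<in> V" "x' < y'"
    using neg by (auto simp: precedes_def not_le)
  obtain s t where st: "s \<in> U" "t \<in> U" "s < t" using U by (auto simp: fat_def)
  obtain s' t' where st': "s' \<in> V" "t' \<in> V" "s' < t'" using V by (auto simp: fat_def)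
  define a where "a = min s x'"
  define b where "b = max t x"
  define c where "c = min s' y"
  define d where "d = max t' y'"
  have mem: "a \<in> U" "b \<in> U" "c \<in> V" "d \<in> V"
    using xy st st' by (auto simp: a_def b_def c_def d_def min_def max_def)
  have lt: "max a c < min b d"
    using xy st st' by (auto simp: a_def b_def c_def d_def min_def max_def)
  have "max a c \<in> U" "min b d \<in> U" "max a c \<in> V" "min b d \<in> V"
    using fat_Icc_subset [OF U mem(1,2)] fat_Icc_subset [OF V mem(3,4)] lt by auto
  then have "fat (U \<inter> V)" using fat_Int U V lt by blast
  with neg show False by blast
qed

section \<open>Chains of connected sets and interval maps without fixed points\<close>

lemma connected_chain_union:
  fixes A :: "nat \<Rightarrow> 'a::topological_space set"
  assumes "\<And>k. connected (A k)" "\<And>k. A k \<inter> A (Suc k) \<noteq> {}"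
  shows "connected (\<Union>k. A k)"
proof -
  have "connected (\<Union>k\<le>n. A k)" for n
  proof (induction n)
    case (Suc n)
    have "(\<Union>k\<le>n. A k) \<inter> A (Suc n) \<noteq> {}" using assms(2) [of n] by fastforce
    then have "connected ((\<Union>k\<le>n. A k) \<union> A (Suc n))"
      by (intro connected_Un Suc assms(1))
    then show ?case by (simp add: atMost_Suc Un_commute)
  qed (simp add: assms(1))
  moreover have "A 0 \<noteq> {}" using assms(2) [of 0] by blast
  ultimately have "connected (\<Union>n. \<Union>k\<le>n. A k)"
    by (intro connected_Union) auto
  moreover have "(\<Union>n. \<Union>k\<le>n. A k) = (\<Union>k. A k)" by blast
  ultimately show ?thesis by simp
qed

lemma no_fixpoint_sign:
  fixes g :: "real \<Rightarrow> real"
  assumes "connected L" "continuous_on L g" "\<And>x. x \<in> L \<Longrightarrow> g x \<noteq> x"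
  shows "(\<forall>x\<in>L. x < g x) \<or> (\<forall>x\<in>L. g x < x)"
proof (rule ccontr)
  assume "\<not> ?thesis"
  then obtain x y where xy: "x \<in> L" "y \<in> L" "g x < x" "y < g y"
    using assms(3) by (meson linorder_neqE)
  have "connected ((\<lambda>x. g x - x) ` L)"
    by (intro connected_continuous_image continuous_intros assms)
  then have "0 \<in> (\<lambda>x. g x - x) ` L"
    by (rule connectedD_interval [of _ "g x - x" "g y - y"]) (use xy in auto)
  with assms(3) show False by auto
qed

text \<open>Each orbit increases to a fixed point \<open>c\<close> of \<open>g\<close>, which
  therefore lies outside \<open>L\<close>. A point of \<open>L\<close> above \<open>c\<close> would
  force \<open>c\<close> into the interval \<open>L\<close>, so \<open>c\<close> is the supremum of
  \<open>L\<close> and does not depend on the starting point.\<close>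

lemma orbit_tends_to_common_limit_incr:
  fixes g :: "real \<Rightarrow> real"
  assumes L: "connected L" "L \<subseteq> {0..1}" "L \<noteq> {}" and g: "continuous_on {0..1} g" "g ` L \<subseteq> L"
    and up: "\<And>x. x \<in> L \<Longrightarrow> x < g x"
  shows "\<exists>c. \<forall>x\<in>L. (\<lambda>k. (g ^^ k) x) \<longlonglongrightarrow> c"
proof -
  have lim: "(\<lambda>k. (g ^^ k) x) \<longlonglongrightarrow> Sup L" if x: "x \<in> L" for x
  proof -
    have bdd: "bdd_above L" using L(2) by (meson bdd_above_Icc bdd_above_mono)
    have mem: "(g ^^ k) x \<in> L" for k using x g(2) by (induction k) auto
    then have memI: "(g ^^ k) x \<in> {0..1}" for k using L(2) by blast
    have "incseq (\<lambda>k. (g ^^ k) x)" using up mem by (intro incseq_SucI) (simp add: less_imp_le)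
    moreover have "\<forall>k. (g ^^ k) x \<le> 1" using mem L(2) by (meson atLeastAtMost_iff subsetD)
    ultimately obtain c where c: "(\<lambda>k. (g ^^ k) x) \<longlonglongrightarrow> c" "\<And>k. (g ^^ k) x \<le> c"
      using incseq_convergent by blast
    have cI: "c \<in> {0..1}"
      using memI by (intro closed_sequentially [OF closed_atLeastAtMost _ c(1)])
    have "(\<lambda>k. g ((g ^^ k) x)) \<longlonglongrightarrow> g c"
      by (rule continuous_on_tendsto_compose [OF g(1) c(1) cI]) (use memI in auto)
    moreover have "(\<lambda>k. g ((g ^^ k) x)) \<longlonglongrightarrow> c"
      using LIMSEQ_Suc [OF c(1)] by simp
    ultimately have "g c = c" by (rule LIMSEQ_unique)
    then have notin: "c \<notin> L" using up by force
    have "y \<le> c" if "y \<in> L" for y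
      using notin connectedD_interval [OF L(1) x that, of c] c(2) [of 0] by fastforce
    then have "Sup L \<le> c" using L(3) by (intro cSup_least)
    moreover have "c \<le> Sup L"
      by (rule LIMSEQ_le_const2 [OF c(1)]) (use mem bdd in \<open>auto intro: cSup_upper\<close>)
    ultimately show ?thesis using c(1) by simp
  qed
  then show ?thesis by blast
qed

text \<open>Conjugation with the reflection \<open>1 - x\<close> turns this into the increasing
  case.\<close>

lemma orbit_tends_to_common_limit_decr:
  fixes g :: "real \<Rightarrow> real"
  assumes L: "connected L" "L \<subseteq> {0..1}" "L \<noteq> {}" and g: "continuous_on {0..1} g" "g ` L \<subseteq> L"
    and down: "\<And>x. x \<in> L \<Longrightarrow> g x < x"
  shows "\<exists>c. \<forall>x\<in>L. (\<lambda>k. (g ^^ k) x) \<longlonglongrightarrow> c"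
proof -
  define h where "h x = 1 - g (1 - x)" for x
  define K where "K = (\<lambda>x. 1 - x) ` L"
  have hk: "(h ^^ k) (1 - x) = 1 - (g ^^ k) x" for k x
    by (induction k) (simp_all add: h_def)
  have "connected K" unfolding K_def by (intro connected_continuous_image continuous_intros L)
  moreover have "K \<subseteq> {0..1}" "K \<noteq> {}" using L by (auto simp: K_def)
  moreover have "continuous_on {0..1} h" unfolding h_def
    by (intro continuous_intros continuous_on_compose2 [OF g(1)]) auto
  moreover have "h ` K \<subseteq> K" using g(2) by (auto simp: K_def h_def)
  moreover have "\<And>x. x \<in> K \<Longrightarrow> x < h x" using down by (auto simp: K_def h_def)
  ultimately obtain c where c: "\<forall>x\<in>K. (\<lambda>k. (h ^^ k) x) \<longlonglongrightarrow> c"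
    using orbit_tends_to_common_limit_incr by blast
  have "(\<lambda>k. (g ^^ k) x) \<longlonglongrightarrow> 1 - c" if "x \<in> L" for x
  proof -
    have "(\<lambda>k. 1 - (g ^^ k) x) \<longlonglongrightarrow> c" using c that hk by (auto simp: K_def)
    then have "(\<lambda>k. 1 - (1 - (g ^^ k) x)) \<longlonglongrightarrow> 1 - c" by (intro tendsto_intros)
    then show ?thesis by simp
  qed
  then show ?thesis by blast
qed

section \<open>Overlapping images of fat sets\<close>

text \<open>Dense chaos is assumed in its form for fat sets; the final proof obtains
  \<open>dense\<close> from the topological definition with small balls around midpoints.\<close>

locale chaotic_interval_map =
  fixes f :: "real \<Rightarrow> real" and \<epsilon> :: real
  assumes eps_pos: "\<epsilon> > 0"
    and cont: "continuous_on {0..1} f"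
    and maps: "f ` {0..1} \<subseteq> {0..1}"
    and dense: "\<lbrakk>fat U; fat V\<rbrakk> \<Longrightarrow> \<exists>u\<in>U. \<exists>v\<in>V. chaotic_seq \<epsilon> (\<lambda>n. \<bar>(f ^^ n) u - (f ^^ n) v\<bar>)"
begin

section \<open>Iterates of a densely chaotic interval map\<close>

definition chaotic :: "real \<Rightarrow> real \<Rightarrow> bool" where
  "chaotic u v \<longleftrightarrow> chaotic_seq \<epsilon> (\<lambda>n. \<bar>(f ^^ n) u - (f ^^ n) v\<bar>)"

lemma chaotic_near:
  assumes "chaotic u v" "\<delta> > 0" shows "\<exists>n\<ge>N. \<bar>(f ^^ n) u - (f ^^ n) v\<bar> < \<delta>"
  using assms by (simp add: chaotic_def chaotic_seq_def)

lemma chaotic_far: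
  assumes "chaotic u v" shows "\<exists>n\<ge>N. \<bar>(f ^^ n) u - (f ^^ n) v\<bar> > \<epsilon>"
proof -
  obtain e where "e > \<epsilon>" "\<forall>N. \<exists>n\<ge>N. \<bar>(f ^^ n) u - (f ^^ n) v\<bar> > e"
    using assms unfolding chaotic_def chaotic_seq_def by blast
  then show ?thesis by (meson order_less_trans)
qed

lemma obtain_chaotic:
  assumes "fat U" "fat V" obtains u v where "u \<in> U" "v \<in> V" "chaotic u v"
  using dense [OF assms] that by (auto simp: chaotic_def)

lemma iterate_mem: "x \<in> {0..1} \<Longrightarrow> (f ^^ n) x \<in> {0..1}"
  using maps by (induction n) (simp_all add: image_subset_iff del: atLeastAtMost_iff)

lemma iterate_cont: "continuous_on {0..1} (f ^^ n)"
proof (induction n)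
  case (Suc n)
  have "continuous_on {0..1} (f \<circ> f ^^ n)"
    by (intro continuous_on_compose Suc continuous_on_subset [OF cont]) (use iterate_mem in blast)
  then show ?case by simp
qed (simp add: id_def)

lemma iterate_image_add: "(f ^^ (m + n)) ` U = (f ^^ m) ` (f ^^ n) ` U"
  by (simp add: funpow_add image_comp)

lemma iterate_mult: "(f ^^ (m * k)) x = ((f ^^ m) ^^ k) x"
  by (simp add: funpow_mult mult.commute)

text \<open>Handling all times up to \<open>M\<close> at once makes it possible to pass between
  closeness at multiples of \<open>M\<close> and closeness at arbitrary times.\<close>

lemma uniform_below:
  assumes "\<eta> > 0"
  shows "\<exists>\<delta>>0. \<forall>x\<in>{0..1}. \<forall>y\<in>{0..1}. \<forall>r\<le>M. \<bar>x - y\<bar> < \<delta> \<longrightarrow> \<bar>(f ^^ r) x - (f ^^ r) y\<bar> < \<eta>"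
proof (induction M)
  case 0 with assms show ?case by auto
next
  case (Suc M)
  then obtain \<delta> where \<delta>: "\<delta> > 0"
    "\<And>x y r. \<lbrakk>x \<in> {0..1}; y \<in> {0..1}; r \<le> M; \<bar>x - y\<bar> < \<delta>\<rbrakk> \<Longrightarrow> \<bar>(f ^^ r) x - (f ^^ r) y\<bar> < \<eta>"
    by blast
  have "uniformly_continuous_on {0..1} (f ^^ Suc M)"
    by (intro compact_uniformly_continuous iterate_cont compact_Icc)
  then obtain \<delta>' where \<delta>': "\<delta>' > 0"
    "\<And>x y. \<lbrakk>x \<in> {0..1}; y \<in> {0..1}; \<bar>x - y\<bar> < \<delta>'\<rbrakk> \<Longrightarrow> \<bar>(f ^^ Suc M) x - (f ^^ Suc M) y\<bar> < \<eta>"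
    using assms unfolding uniformly_continuous_on_def dist_real_def by metis
  show ?case
  proof (intro exI [of _ "min \<delta> \<delta>'"] conjI ballI allI impI)
    fix x y r
    assume "x \<in> {0..1::real}" "y \<in> {0..1::real}" "r \<le> Suc M" "\<bar>x - y\<bar> < min \<delta> \<delta>'"
    then show "\<bar>(f ^^ r) x - (f ^^ r) y\<bar> < \<eta>"
      using \<delta>(2) [of x y r] \<delta>'(2) [of x y] by (cases "r = Suc M") auto
  qed (use \<delta>(1) \<delta>'(1) in simp)
qed

text \<open>Once the two orbits are close at the multiples of \<open>M\<close>, uniform continuity
  of the first \<open>M\<close> iterates keeps them within \<open>\<epsilon>\<close> at all later
  times, against the limit superior.\<close>

lemma chaotic_not_same_limit:
  assumes "chaotic u v" "u \<in> {0..1}" "v \<in> {0..1}" "M \<ge> 1"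
    and u: "(\<lambda>k. (f ^^ (M * k)) u) \<longlonglongrightarrow> c" and v: "(\<lambda>k. (f ^^ (M * k)) v) \<longlonglongrightarrow> c"
  shows False
proof -
  obtain \<delta> where \<delta>: "\<delta> > 0"
    "\<And>x y r. \<lbrakk>x \<in> {0..1}; y \<in> {0..1}; r \<le> M; \<bar>x - y\<bar> < \<delta>\<rbrakk> \<Longrightarrow> \<bar>(f ^^ r) x - (f ^^ r) y\<bar> < \<epsilon>"
    using uniform_below [OF eps_pos, of M] by blast
  have "(\<lambda>k. (f ^^ (M * k)) u - (f ^^ (M * k)) v) \<longlonglongrightarrow> c - c" by (intro tendsto_intros u v)
  then obtain K where K: "\<And>k. k \<ge> K \<Longrightarrow> \<bar>(f ^^ (M * k)) u - (f ^^ (M * k)) v\<bar> < \<delta>"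
    using \<delta>(1) by (fastforce dest: LIMSEQ_D)
  have "\<bar>(f ^^ n) u - (f ^^ n) v\<bar> < \<epsilon>" if "n \<ge> M * K" for n
  proof -
    have n: "n = n mod M + M * (n div M)" by simp
    have "K \<le> n div M" using that \<open>M \<ge> 1\<close> by (simp add: less_eq_div_iff_mult_less_eq mult.commute)
    moreover have "n mod M \<le> M" using \<open>M \<ge> 1\<close> by (simp add: less_imp_le)
    ultimately have "\<bar>(f ^^ (n mod M)) ((f ^^ (M * (n div M))) u) - (f ^^ (n mod M)) ((f ^^ (M * (n div M))) v)\<bar> < \<epsilon>"
      by (intro \<delta>(2) K iterate_mem assms)
    then show ?thesis by (metis n comp_apply funpow_add)
  qed
  with chaotic_far [OF assms(1), of "M * K"] show False by force
qed

text \<open>The orbits of a chaotic pair in \<open>U\<close> never merge, because merged orbits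
  could not separate again; so the image keeps two distinct points.\<close>

lemma fat_iterate:
  assumes "fat U" shows "fat ((f ^^ n) ` U)"
proof -
  obtain u v where uv: "u \<in> U" "v \<in> U" "chaotic u v" using obtain_chaotic assms by metis
  obtain k where k: "k \<ge> n" "\<bar>(f ^^ k) u - (f ^^ k) v\<bar> > \<epsilon>"
    using chaotic_far [OF uv(3)] by blast
  have "(f ^^ n) u \<noteq> (f ^^ n) v"
  proof
    assume "(f ^^ n) u = (f ^^ n) v"
    then have "(f ^^ (k - n + n)) u = (f ^^ (k - n + n)) v" by (simp add: funpow_add del: le_add_diff_inverse2)
    with k eps_pos show False by simp
  qed
  then have "\<exists>x\<in>(f ^^ n) ` U. \<exists>y\<in>(f ^^ n) ` U. x < y"
    using uv by (meson imageI linorder_neqE)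
  moreover have "connected ((f ^^ n) ` U)"
    using assms by (auto simp: fat_def intro: connected_continuous_image continuous_on_subset [OF iterate_cont])
  moreover have "(f ^^ n) ` U \<subseteq> {0..1}" using assms iterate_mem by (auto simp: fat_def simp del: atLeastAtMost_iff)
  ultimately show ?thesis by (simp add: fat_def)
qed

text \<open>Successive images interlace, so all orbits along the multiples of \<open>M\<close> have the same limit.\<close>

lemma not_monotone_images_up:
  assumes "fat G" "M \<ge> 1"
    and mono: "\<And>k. precedes ((f ^^ (M * k)) ` G) ((f ^^ (M * Suc k)) ` G)"
  shows False
proof -
  obtain u v where uv: "u \<in> G" "v \<in> G" "chaotic u v" using obtain_chaotic assms by metis
  have I: "G \<subseteq> {0..1}" using assms by (auto simp: fat_def)
  have step: "(f ^^ (M * k)) x \<le> (f ^^ (M * Suc k)) y" if "x \<in> G" "y \<in> G" for x y k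
    using precedesD [OF mono] that by blast
  have "incseq (\<lambda>k. (f ^^ (M * k)) u)" by (intro incseq_SucI step uv)
  moreover have "\<forall>k. (f ^^ (M * k)) u \<le> 1" using iterate_mem I uv(1) by (meson atLeastAtMost_iff subsetD)
  ultimately obtain c where c: "(\<lambda>k. (f ^^ (M * k)) u) \<longlonglongrightarrow> c" using incseq_convergent by blast
  have "(\<lambda>k. (f ^^ (M * Suc k)) v) \<longlonglongrightarrow> c"
  proof (rule tendsto_sandwich [OF _ _ c])
    show "(\<lambda>k. (f ^^ (M * Suc (Suc k))) u) \<longlonglongrightarrow> c" using c by (intro LIMSEQ_Suc)
    show "\<forall>\<^sub>F k in sequentially. (f ^^ (M * k)) u \<le> (f ^^ (M * Suc k)) v"
      "\<forall>\<^sub>F k in sequentially. (f ^^ (M * Suc k)) v \<le> (f ^^ (M * Suc (Suc k))) u"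
      by (intro always_eventually allI step uv)+
  qed
  then have "(\<lambda>k. (f ^^ (M * k)) v) \<longlonglongrightarrow> c" by (rule LIMSEQ_imp_Suc)
  with chaotic_not_same_limit uv assms(2) I c show False by blast
qed

lemma not_monotone_images_down:
  assumes "fat G" "M \<ge> 1"
    and mono: "\<And>k. precedes ((f ^^ (M * Suc k)) ` G) ((f ^^ (M * k)) ` G)"
  shows False
proof -
  obtain u v where uv: "u \<in> G" "v \<in> G" "chaotic u v" using obtain_chaotic assms by metis
  have I: "G \<subseteq> {0..1}" using assms by (auto simp: fat_def)
  have step: "(f ^^ (M * Suc k)) x \<le> (f ^^ (M * k)) y" if "x \<in> G" "y \<in> G" for x y k
    using precedesD [OF mono] that by blast
  have "decseq (\<lambda>k. (f ^^ (M * k)) u)" by (intro decseq_SucI step uv)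
  moreover have "\<forall>k. 0 \<le> (f ^^ (M * k)) u" using iterate_mem I uv(1) by (meson atLeastAtMost_iff subsetD)
  ultimately obtain c where c: "(\<lambda>k. (f ^^ (M * k)) u) \<longlonglongrightarrow> c" using decseq_convergent by blast
  have "(\<lambda>k. (f ^^ (M * Suc k)) v) \<longlonglongrightarrow> c"
  proof (rule tendsto_sandwich [OF _ _ _ c])
    show "(\<lambda>k. (f ^^ (M * Suc (Suc k))) u) \<longlonglongrightarrow> c" using c by (intro LIMSEQ_Suc)
    show "\<forall>\<^sub>F k in sequentially. (f ^^ (M * Suc k)) v \<le> (f ^^ (M * k)) u"
      "\<forall>\<^sub>F k in sequentially. (f ^^ (M * Suc (Suc k))) u \<le> (f ^^ (M * Suc k)) v"
      by (intro always_eventually allI step uv)+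
  qed
  then have "(\<lambda>k. (f ^^ (M * k)) v) \<longlonglongrightarrow> c" by (rule LIMSEQ_imp_Suc)
  with chaotic_not_same_limit uv assms(2) I c show False by blast
qed

section \<open>Periodic points in the orbits of fat sets\<close>

text \<open>At infinitely many times the image of \<open>J\<close> is longer than
  \<open>\<epsilon>\<close> and so contains one of finitely many grid points; two of these times
  share a grid point.\<close>

lemma exists_self_intersection:
  assumes "fat J"
  shows "\<exists>n m. m \<ge> 1 \<and> (f ^^ n) ` J \<inter> (f ^^ (n + m)) ` J \<noteq> {}"
proof -
  obtain u v where uv: "u \<in> J" "v \<in> J" "chaotic u v" using obtain_chaotic assms by metis
  define S where "S = {n. \<bar>(f ^^ n) u - (f ^^ n) v\<bar> > \<epsilon>}"
  have "\<exists>n\<ge>N. n \<in> S" for N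
    using chaotic_far [OF uv(3)] by (simp add: S_def)
  then have inf: "infinite S" by (metis infinite_nat_iff_unbounded_le)
  \<comment> \<open>A long image contains a point of the grid \<open>\<epsilon>\<int>\<close>.\<close>
  have "\<exists>k\<in>{0..\<lfloor>1 / \<epsilon>\<rfloor>}. of_int k * \<epsilon> \<in> (f ^^ n) ` J" if "n \<in> S" for n
  proof -
    define a where "a = min ((f ^^ n) u) ((f ^^ n) v)"
    define b where "b = max ((f ^^ n) u) ((f ^^ n) v)"
    have ab: "a \<in> (f ^^ n) ` J" "b \<in> (f ^^ n) ` J" "b - a > \<epsilon>"
      using uv that by (auto simp: a_def b_def S_def min_def max_def)
    have "a \<in> {0..1}" "b \<in> {0..1}" using fat_iterate [OF assms, of n] ab by (auto simp: fat_def)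
    \<comment> \<open>This is the index of the first grid point at or above \<open>a\<close>; it
      does not pass \<open>b\<close> because \<open>b - a > \<epsilon>\<close>.\<close>
    define k where "k = \<lceil>a / \<epsilon>\<rceil>"
    have "a / \<epsilon> \<le> of_int k" "of_int k < a / \<epsilon> + 1" unfolding k_def by linarith+
    then have "a \<le> of_int k * \<epsilon>" "of_int k * \<epsilon> < a + \<epsilon>"
      using eps_pos by (simp_all add: field_simps)
    then have kab: "a \<le> of_int k * \<epsilon>" "of_int k * \<epsilon> \<le> b" using ab(3) by auto
    then have "of_int k * \<epsilon> \<in> (f ^^ n) ` J" using fat_Icc_subset [OF fat_iterate [OF assms] ab(1,2)] by auto
    moreover have "k \<ge> 0" using \<open>a \<in> {0..1}\<close> eps_pos by (simp add: k_def) (smt (verit) divide_nonneg_pos)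
    moreover have "of_int k \<le> 1 / \<epsilon>" using kab(2) \<open>b \<in> {0..1}\<close> eps_pos by (simp add: field_simps)
    ultimately show ?thesis by (intro bexI [of _ k]) (auto simp: le_floor_iff)
  qed
  then have "\<forall>n\<in>S. \<exists>k. k \<in> {0..\<lfloor>1 / \<epsilon>\<rfloor>} \<and> of_int k * \<epsilon> \<in> (f ^^ n) ` J" by blast
  from bchoice [OF this] obtain k where
    k: "\<forall>n\<in>S. k n \<in> {0..\<lfloor>1 / \<epsilon>\<rfloor>} \<and> of_int (k n) * \<epsilon> \<in> (f ^^ n) ` J" ..
  then have "k ` S \<subseteq> {0..\<lfloor>1 / \<epsilon>\<rfloor>}" by blast
  then have "finite (k ` S)" by (rule finite_subset) simp
  then have "\<not> inj_on k S" using inf finite_imageD by blast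
  then obtain n n' where n: "n \<in> S" "n' \<in> S" "k n = k n'" "n < n'"
    unfolding inj_on_def by (metis linorder_neqE)
  have "of_int (k n) * \<epsilon> \<in> (f ^^ n) ` J" "of_int (k n') * \<epsilon> \<in> (f ^^ n') ` J"
    using k n(1,2) by blast+
  then have "of_int (k n) * \<epsilon> \<in> (f ^^ n) ` J \<inter> (f ^^ (n + (n' - n))) ` J" using n(3,4) by simp
  with n(4) show ?thesis by (intro exI [of _ n] exI [of _ "n' - n"]) auto
qed

text \<open>The images of \<open>J\<close> along an arithmetic progression chain together to an invariant
  interval \<open>L\<close>; without a periodic point in \<open>L\<close> all its points would be asymptotic.\<close>

lemma reaches_periodic_point:
  assumes "fat J"
  shows "\<exists>n m q. m \<ge> 1 \<and> q \<in> (f ^^ n) ` J \<and> (f ^^ m) q = q"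
proof -
  obtain n m where nm: "m \<ge> 1" "(f ^^ n) ` J \<inter> (f ^^ (n + m)) ` J \<noteq> {}"
    using exists_self_intersection [OF assms] by blast
  define J' where "J' = (f ^^ n) ` J"
  define g where "g = f ^^ m"
  define A where "A k = (f ^^ (m * k)) ` J'" for k
  define L where "L = (\<Union>k. A k)"
  have J': "fat J'" unfolding J'_def by (rule fat_iterate [OF assms])
  have fatA: "fat (A k)" for k unfolding A_def by (rule fat_iterate [OF J'])
  have gA: "g ` A k = A (Suc k)" for k
    by (simp add: A_def g_def flip: iterate_image_add)
  have "A 0 \<inter> A 1 \<noteq> {}"
    using nm(2) by (simp add: A_def J'_def add.commute flip: iterate_image_add)
  then obtain z where z: "z \<in> A 0" "z \<in> A 1" by blast
  \<comment> \<open>A common point of the first two links is carried along by the iterates and joins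
    every link to the next.\<close>
  have "(f ^^ (m * k)) z \<in> A k \<inter> A (Suc k)" for k
  proof -
    have "A (Suc k) = (f ^^ (m * k)) ` A 1"
      by (simp add: A_def add.commute flip: iterate_image_add)
    moreover have "A k = (f ^^ (m * k)) ` A 0" by (simp add: A_def)
    ultimately show ?thesis using z by blast
  qed
  then have "connected L" unfolding L_def
    using fatA by (intro connected_chain_union) (auto simp: fat_def)
  have LI: "L \<subseteq> {0..1}" using fatA by (auto simp: L_def fat_def)
  have gL: "g ` L \<subseteq> L" unfolding L_def image_UN gA by blast
  have J'L: "J' \<subseteq> L" using UN_upper [of 0 UNIV A] by (simp add: L_def A_def)
  have gcont: "continuous_on {0..1} g" unfolding g_def by (rule iterate_cont)
  have "\<exists>q\<in>L. g q = q"
  proof (rule ccontr)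
    assume no: "\<not> ?thesis"
    have "(\<forall>x\<in>L. x < g x) \<or> (\<forall>x\<in>L. g x < x)"
      by (rule no_fixpoint_sign [OF \<open>connected L\<close> continuous_on_subset [OF gcont LI]]) (use no in blast)
    then obtain c where c: "\<And>x. x \<in> L \<Longrightarrow> (\<lambda>k. (g ^^ k) x) \<longlonglongrightarrow> c"
      using orbit_tends_to_common_limit_incr [OF \<open>connected L\<close> LI _ gcont gL]
        orbit_tends_to_common_limit_decr [OF \<open>connected L\<close> LI _ gcont gL]
        fat_nonempty [OF J'] J'L by (metis subset_empty)
    obtain u v where uv: "u \<in> J'" "v \<in> J'" "chaotic u v" using obtain_chaotic J' by metis
    show False
      by (rule chaotic_not_same_limit [OF uv(3) _ _ nm(1), where c = c])
        (use uv J'L LI c in \<open>auto simp: iterate_mult simp flip: g_def\<close>)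
  qed
  then obtain q k where q: "q \<in> A k" "g q = q" by (auto simp: L_def)
  then have "q \<in> (f ^^ (m * k + n)) ` J" by (simp add: A_def J'_def iterate_image_add)
  with q(2) nm(1) show ?thesis unfolding g_def by blast
qed

section \<open>The order of sets whose images never overlap\<close>

text \<open>Images at equal times may still share a single point, for instance a common periodic
  point.\<close>

definition nonoverlapping :: "real set \<Rightarrow> real set \<Rightarrow> bool" where
  "nonoverlapping U V \<longleftrightarrow> (\<forall>n. \<not> fat ((f ^^ n) ` U \<inter> (f ^^ n) ` V))"

lemma nonoverlapping_sym: "nonoverlapping U V \<Longrightarrow> nonoverlapping V U"
  by (simp add: nonoverlapping_def Int_commute)

lemma nonoverlapping_iterate: "nonoverlapping U V \<Longrightarrow> nonoverlapping ((f ^^ n) ` U) ((f ^^ n) ` V)"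
  by (simp add: nonoverlapping_def flip: iterate_image_add)

lemma nonoverlapping_cases:
  assumes "nonoverlapping U V" "fat U" "fat V"
  shows "precedes ((f ^^ n) ` U) ((f ^^ n) ` V) \<or> precedes ((f ^^ n) ` V) ((f ^^ n) ` U)"
  using assms fat_trichotomy [OF fat_iterate fat_iterate] unfolding nonoverlapping_def by blast

lemma fixed_iterate: "(f ^^ m) q = q \<Longrightarrow> (f ^^ (m * k)) q = q"
  by (induction k) (simp_all add: funpow_add)

lemma fixed_iterate_shift: "(f ^^ m) q = q \<Longrightarrow> (f ^^ m) ((f ^^ k) q) = (f ^^ k) q"
  by (metis add.commute comp_apply funpow_add)

text \<open>If the two fixed points agree, then \<open>f\<^sup>m\<close> may exchange the two sides of \<open>q\<close>; passing
  to \<open>f\<^sup>2\<^sup>m\<close> avoids this.\<close>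

lemma order_preserved_step:
  assumes UV: "nonoverlapping U V" "fat U" "fat V" and "precedes U V"
    and q: "q \<in> U" "(f ^^ m) q = q" and r: "r \<in> V" "(f ^^ m) r = r"
  shows "precedes ((f ^^ (2 * m)) ` U) ((f ^^ (2 * m)) ` V)"
proof (rule ccontr)
  assume neg: "\<not> ?thesis"
  define F where "F = f ^^ m"
  have F2: "(f ^^ (2 * m)) ` W = F ` F ` W" for W
    by (simp add: F_def mult_2 iterate_image_add)
  have VU: "precedes (F ` F ` V) (F ` F ` U)"
    using neg nonoverlapping_cases [OF UV, of "2 * m"] by (simp add: F2)
  have Fq: "F q = q" and Fr: "F r = r" using q r by (simp_all add: F_def)
  \<comment> \<open>As fixed points of \<open>F\<close>, \<open>q\<close> and \<open>r\<close> also
    belong to the double images, where the order is reversed.\<close>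
  have "r \<le> q" using precedesD [OF VU, of r q] q(1) r(1) Fq Fr by (metis imageI)
  with precedesD [OF \<open>precedes U V\<close> q(1) r(1)] have "r = q" by simp
  have le: "x \<le> q" if "x \<in> U" for x using precedesD [OF \<open>precedes U V\<close> that r(1)] \<open>r = q\<close> by simp
  have ge: "q \<le> x" if "x \<in> F ` F ` U" for x
    using precedesD [OF VU _ that, of r] r(1) Fr \<open>r = q\<close> by (metis imageI)
  have ge': "q \<le> x" if "x \<in> V" for x using precedesD [OF \<open>precedes U V\<close> q(1) that] by simp
  have FU: "fat (F ` U)" unfolding F_def by (rule fat_iterate [OF UV(2)])
  \<comment> \<open>The double image of \<open>U\<close> lies at or above \<open>q\<close>. A fat
    part of the image of \<open>U\<close> that \<open>F\<close> sends to or below \<open>q\<close>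
    would thus be collapsed to the point \<open>q\<close>.\<close>
  have no_G: False if "fat G" "G \<subseteq> F ` U" and up: "\<And>x. x \<in> F ` G \<Longrightarrow> x \<le> q" for G
  proof -
    have "F ` G \<subseteq> {q}" using ge up that(2) by (force intro: antisym)
    moreover have "fat (F ` G)" unfolding F_def by (rule fat_iterate [OF that(1)])
    ultimately show False using fat_obtain_neq by (metis singletonD subsetD)
  qed
  have qFU: "q \<in> F ` U" using q(1) Fq by (metis imageI)
  obtain b where b: "b \<in> F ` U" "b \<noteq> q" using fat_obtain_neq [OF FU] by blast
  consider "precedes (F ` U) (F ` V)" | "precedes (F ` V) (F ` U)"
    using nonoverlapping_cases [OF UV, of m] by (auto simp: F_def)
  then show False
  proof cases
    case 1
    have FUle: "x \<le> q" if "x \<in> F ` U" for x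
      using precedesD [OF 1 that, of r] r(1) Fr \<open>r = q\<close> by (metis imageI)
    obtain a where a: "a \<in> U" "a \<noteq> q" using fat_obtain_neq [OF UV(2)] by blast
    \<comment> \<open>\<open>U\<close> and its image under \<open>F\<close> both reach
      \<open>q\<close> from the left and so share an interval \<open>{c..q}\<close>; its image stays
      in the image of \<open>U\<close>, at or below \<open>q\<close>.\<close>
    define c where "c = max a b"
    have c: "c < q" using a b le FUle by (fastforce simp: c_def)
    have "{c..q} \<subseteq> U" "{c..q} \<subseteq> F ` U"
      using fat_Icc_subset [OF UV(2) a(1) q(1)] fat_Icc_subset [OF FU b(1) qFU]
      by (auto simp: c_def)
    moreover from this have "fat {c..q}" using c UV(2) by (intro fat_Icc_sub [OF UV(2)]) auto
    ultimately show False using no_G [of "{c..q}"] FUle by blast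
  next
    case 2
    have FUge: "q \<le> x" if "x \<in> F ` U" for x
      using precedesD [OF 2 _ that, of r] r(1) Fr \<open>r = q\<close> by (metis imageI)
    have FVle: "x \<le> q" if "x \<in> F ` V" for x
      using precedesD [OF 2 that qFU] .
    obtain a where a: "a \<in> V" "a \<noteq> q" using fat_obtain_neq [OF UV(3)] by blast
    \<comment> \<open>Now \<open>V\<close> and the image of \<open>U\<close> both start at
      \<open>q\<close> and extend to the right. Their common interval \<open>{q..c}\<close> is sent
      into the image of \<open>V\<close>, at or below \<open>q\<close>.\<close>
    define c where "c = min a b"
    have c: "q < c" using a b ge' FUge by (fastforce simp: c_def)
    have "{q..c} \<subseteq> V" "{q..c} \<subseteq> F ` U"
      using fat_Icc_subset [OF UV(3) _ a(1), of q] r(1) \<open>r = q\<close> fat_Icc_subset [OF FU qFU b(1)]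
      by (auto simp: c_def)
    moreover from this have "fat {q..c}" using c by (intro fat_Icc_sub [OF UV(3)]) auto
    ultimately show False using no_G [of "{q..c}"] FVle by blast
  qed
qed

text \<open>The fixed points \<open>q\<close> and \<open>r\<close> remain in all these images, so
  the single step can be repeated.\<close>

lemma order_preserved:
  assumes UV: "nonoverlapping U V" "fat U" "fat V" and "precedes U V"
    and q: "q \<in> U" "(f ^^ m) q = q" and r: "r \<in> V" "(f ^^ m) r = r"
  shows "precedes ((f ^^ (2 * m * k)) ` U) ((f ^^ (2 * m * k)) ` V)"
proof (induction k)
  case 0 then show ?case using \<open>precedes U V\<close> by simp
next
  case (Suc k)
  let ?U = "(f ^^ (2 * m * k)) ` U" and ?V = "(f ^^ (2 * m * k)) ` V"
  have "q \<in> ?U" "r \<in> ?V"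
    using fixed_iterate [OF q(2), of "2 * k"] fixed_iterate [OF r(2), of "2 * k"] q(1) r(1)
    by (metis imageI mult.assoc mult.commute)+
  then have "precedes ((f ^^ (2 * m)) ` ?U) ((f ^^ (2 * m)) ` ?V)"
    by (intro order_preserved_step [OF _ _ _ Suc _ q(2) _ r(2)] nonoverlapping_iterate fat_iterate UV)
  then show ?case by (simp flip: iterate_image_add)
qed

text \<open>A chaotic pair from the outer sets squeezes an image of \<open>V\<^sub>2\<close> to \<open>q\<^sub>2\<close>, so an image of an outer
  set meets \<open>V\<^sub>2\<close> in an interval \<open>G\<close>, and the constant order makes the images of \<open>G\<close> monotone.\<close>

lemma ordered_triple_False:
  assumes fat: "fat V\<^sub>1" "fat V\<^sub>2" "fat V\<^sub>3" and "M \<ge> 1"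
    and ord12: "\<And>k. precedes ((f ^^ (M * k)) ` V\<^sub>1) ((f ^^ (M * k)) ` V\<^sub>2)"
    and ord23: "\<And>k. precedes ((f ^^ (M * k)) ` V\<^sub>2) ((f ^^ (M * k)) ` V\<^sub>3)"
    and q1: "q\<^sub>1 \<in> V\<^sub>1" "(f ^^ M) q\<^sub>1 = q\<^sub>1" and q2: "q\<^sub>2 \<in> V\<^sub>2" "(f ^^ M) q\<^sub>2 = q\<^sub>2"
    and q3: "q\<^sub>3 \<in> V\<^sub>3" "(f ^^ M) q\<^sub>3 = q\<^sub>3"
  shows False
proof -
  obtain u w where uw: "u \<in> V\<^sub>1" "w \<in> V\<^sub>3" "chaotic u w" using obtain_chaotic fat by metis
  have I: "u \<in> {0..1}" "w \<in> {0..1}" using uw fat by (auto simp: fat_def)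
  \<comment> \<open>Chaos gives closeness at some time \<open>n\<close>. Advancing by between 1 and
    \<open>M\<close> steps to the next multiple of \<open>M\<close> preserves it by uniform
    continuity and makes that multiple positive.\<close>
  have near: "\<exists>k\<ge>1. \<bar>(f ^^ (M * k)) u - (f ^^ (M * k)) w\<bar> < \<eta>" if pos: "\<eta> > 0" for \<eta>
  proof -
    obtain \<delta> where \<delta>: "\<delta> > 0"
      "\<And>x y r. \<lbrakk>x \<in> {0..1}; y \<in> {0..1}; r \<le> M; \<bar>x - y\<bar> < \<delta>\<rbrakk> \<Longrightarrow> \<bar>(f ^^ r) x - (f ^^ r) y\<bar> < \<eta>"
      using uniform_below [OF pos, of M] by blast
    obtain n where n: "\<bar>(f ^^ n) u - (f ^^ n) w\<bar> < \<delta>" using chaotic_near [OF uw(3) \<delta>(1)] by blast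
    define r where "r = M - n mod M"
    have "n mod M < M" using \<open>M \<ge> 1\<close> by simp
    then have "r + n = M * Suc (n div M)" using minus_mod_eq_mult_div [of n M] mod_less_eq_dividend [of n M]
      unfolding r_def mult_Suc_right by linarith
    moreover have "\<bar>(f ^^ (r + n)) u - (f ^^ (r + n)) w\<bar> < \<eta>"
      unfolding funpow_add comp_apply by (intro \<delta>(2) iterate_mem I n) (simp add: r_def)
    ultimately show ?thesis by (metis One_nat_def Suc_le_mono le0)
  qed
  have fixed: "q\<^sub>1 \<in> (f ^^ (M * k)) ` V\<^sub>1" "q\<^sub>2 \<in> (f ^^ (M * k)) ` V\<^sub>2" "q\<^sub>3 \<in> (f ^^ (M * k)) ` V\<^sub>3" for k
    using q1 q2 q3 fixed_iterate by (metis imageI)+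
  \<comment> \<open>The fixed point \<open>q\<^sub>2\<close> lies in every image of
    \<open>V\<^sub>2\<close>, so it separates the two orbits along the multiples of
    \<open>M\<close>.\<close>
  have between: "(f ^^ (M * k)) u \<le> q\<^sub>2" "q\<^sub>2 \<le> (f ^^ (M * k)) w" for k
    using precedesD [OF ord12 _ fixed(2)] precedesD [OF ord23 fixed(2)] uw by blast+
  have V12: "x \<le> y" if "x \<in> V\<^sub>1" "y \<in> V\<^sub>2" for x y using precedesD [OF ord12 [of 0]] that by simp
  have V23: "x \<le> y" if "x \<in> V\<^sub>2" "y \<in> V\<^sub>3" for x y using precedesD [OF ord23 [of 0]] that by simp
  \<comment> \<open>A set \<open>G\<close> inside both \<open>V\<^sub>2\<close> and the image of an
    outer \<open>V\<close> is seen twice: its \<open>j\<close>-th image lies in an image of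
    \<open>V\<close>, its next image in the image of \<open>V\<^sub>2\<close> at the same time. The
    constant order then compares successive images of \<open>G\<close>.\<close>
  have shift: "(f ^^ (M * k * j)) ` G \<subseteq> (f ^^ (M * (k * Suc j))) ` V" if "G \<subseteq> (f ^^ (M * k)) ` V" for G V j k
  proof -
    have "(f ^^ (M * (k * Suc j))) ` V = (f ^^ (M * k * j)) ` (f ^^ (M * k)) ` V"
      by (simp add: algebra_simps flip: iterate_image_add)
    then show ?thesis using that by (simp add: image_mono)
  qed
  have shift2: "(f ^^ (M * k * Suc j)) ` G \<subseteq> (f ^^ (M * (k * Suc j))) ` V\<^sub>2" if "G \<subseteq> V\<^sub>2" for G j k
    using that by (simp add: image_mono algebra_simps)
  obtain c where c: "c \<in> V\<^sub>2" "c \<noteq> q\<^sub>2" using fat_obtain_neq [OF fat(2)] by blast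
  show False
  \<comment> \<open>The side of \<open>q\<^sub>2\<close> on which \<open>V\<^sub>2\<close> has a
    further point \<open>c\<close> decides which outer set is used: its orbit point comes closer to
    \<open>q\<^sub>2\<close> than \<open>c\<close>, while its own fixed point lies on the far side
    of \<open>c\<close>.\<close>
  proof (cases "c < q\<^sub>2")
    case True
    obtain k where k: "k \<ge> 1" "\<bar>(f ^^ (M * k)) u - (f ^^ (M * k)) w\<bar> < q\<^sub>2 - c"
      using near [of "q\<^sub>2 - c"] True by auto
    define b where "b = (f ^^ (M * k)) u"
    have b: "c < b" "b \<le> q\<^sub>2" using k(2) between [of k] by (auto simp: b_def)
    have "{q\<^sub>1..b} \<subseteq> (f ^^ (M * k)) ` V\<^sub>1"
      by (rule fat_Icc_subset [OF fat_iterate [OF fat(1)] fixed(1)]) (simp add: b_def uw)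
    then have G1: "{c..b} \<subseteq> (f ^^ (M * k)) ` V\<^sub>1" using V12 [OF q1(1) c(1)] by auto
    have G2: "{c..b} \<subseteq> V\<^sub>2" using fat_Icc_subset [OF fat(2) c(1) q2(1)] b by auto
    have "fat {c..b}" by (rule fat_Icc_sub [OF fat(2)]) (use G2 b in auto)
    moreover have "M * k \<ge> 1" using k(1) \<open>M \<ge> 1\<close> by simp
    ultimately show False
      by (rule not_monotone_images_up) (rule precedes_mono [OF ord12 shift [OF G1] shift2 [OF G2]])
  next
    case False
    with c(2) have "q\<^sub>2 < c" by simp
    obtain k where k: "k \<ge> 1" "\<bar>(f ^^ (M * k)) u - (f ^^ (M * k)) w\<bar> < c - q\<^sub>2"
      using near [of "c - q\<^sub>2"] \<open>q\<^sub>2 < c\<close> by auto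
    define b where "b = (f ^^ (M * k)) w"
    have b: "b < c" "q\<^sub>2 \<le> b" using k(2) between [of k] by (auto simp: b_def)
    have "{b..q\<^sub>3} \<subseteq> (f ^^ (M * k)) ` V\<^sub>3"
      by (rule fat_Icc_subset [OF fat_iterate [OF fat(3)] _ fixed(3)]) (simp add: b_def uw)
    then have G3: "{b..c} \<subseteq> (f ^^ (M * k)) ` V\<^sub>3" using V23 [OF c(1) q3(1)] by auto
    have G2: "{b..c} \<subseteq> V\<^sub>2" using fat_Icc_subset [OF fat(2) q2(1) c(1)] b by auto
    have "fat {b..c}" by (rule fat_Icc_sub [OF fat(2)]) (use G2 b in auto)
    moreover have "M * k \<ge> 1" using k(1) \<open>M \<ge> 1\<close> by simp
    ultimately show False
      by (rule not_monotone_images_down) (rule precedes_mono [OF ord23 shift2 [OF G2] shift [OF G3]])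
  qed
qed

text \<open>Passing to a common time and a common period puts a fixed point of one iterate into each
  set. The order of the three sets is then constant along multiples of twice the period, which the
  ordered case excludes.\<close>

lemma no_nonoverlapping_triple:
  assumes fat: "fat U\<^sub>1" "fat U\<^sub>2" "fat U\<^sub>3"
    and nov: "nonoverlapping U\<^sub>1 U\<^sub>2" "nonoverlapping U\<^sub>2 U\<^sub>3" "nonoverlapping U\<^sub>1 U\<^sub>3"
  shows False
proof -
  obtain n1 m1 p1 where p1: "m1 \<ge> 1" "p1 \<in> (f ^^ n1) ` U\<^sub>1" "(f ^^ m1) p1 = p1"
    using reaches_periodic_point [OF fat(1)] by blast
  obtain n2 m2 p2 where p2: "m2 \<ge> 1" "p2 \<in> (f ^^ n2) ` U\<^sub>2" "(f ^^ m2) p2 = p2"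
    using reaches_periodic_point [OF fat(2)] by blast
  obtain n3 m3 p3 where p3: "m3 \<ge> 1" "p3 \<in> (f ^^ n3) ` U\<^sub>3" "(f ^^ m3) p3 = p3"
    using reaches_periodic_point [OF fat(3)] by blast
  \<comment> \<open>Advancing a periodic point along its orbit keeps its period, so \<open>N\<close>
    only has to exceed all three times and \<open>m\<close> to be a common multiple.\<close>
  define N where "N = n1 + n2 + n3"
  define m where "m = m1 * m2 * m3"
  define P where "P V \<longleftrightarrow> fat V \<and> (\<exists>q\<in>V. (f ^^ m) q = q)" for V
  have P: "P ((f ^^ N) ` U)"
    if U: "fat U" "p \<in> (f ^^ n) ` U" "(f ^^ m') p = p" "n \<le> N" "m' dvd m" for U p n m'
  proof -
    have "(f ^^ (N - n)) p \<in> (f ^^ (N - n + n)) ` U" using U(2) unfolding iterate_image_add by blast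
    moreover have "(f ^^ m) ((f ^^ (N - n)) p) = (f ^^ (N - n)) p"
      using fixed_iterate_shift [OF fixed_iterate [OF U(3)]] U(5) by (metis dvdE)
    ultimately show ?thesis using fat_iterate [OF U(1)] U(4) unfolding P_def by auto
  qed
  have P123: "P ((f ^^ N) ` U\<^sub>1)" "P ((f ^^ N) ` U\<^sub>2)" "P ((f ^^ N) ` U\<^sub>3)"
    using P [OF fat(1) p1(2,3)] P [OF fat(2) p2(2,3)] P [OF fat(3) p3(2,3)] by (simp_all add: N_def m_def)
  have "m \<ge> 1" using p1 p2 p3 by (simp add: m_def)
  have ordered: False
    if V: "P V\<^sub>1" "P V\<^sub>2" "P V\<^sub>3" "nonoverlapping V\<^sub>1 V\<^sub>2" "nonoverlapping V\<^sub>2 V\<^sub>3" "precedes V\<^sub>1 V\<^sub>2" "precedes V\<^sub>2 V\<^sub>3"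
    for V\<^sub>1 V\<^sub>2 V\<^sub>3
  proof -
    obtain q1 q2 q3 where q: "q1 \<in> V\<^sub>1" "(f ^^ m) q1 = q1" "q2 \<in> V\<^sub>2" "(f ^^ m) q2 = q2"
      "q3 \<in> V\<^sub>3" "(f ^^ m) q3 = q3" and fat: "fat V\<^sub>1" "fat V\<^sub>2" "fat V\<^sub>3"
      using V(1-3) by (auto simp: P_def)
    have "(f ^^ (2 * m)) q1 = q1" "(f ^^ (2 * m)) q2 = q2" "(f ^^ (2 * m)) q3 = q3"
      using fixed_iterate [of m _ 2] q by (simp_all add: mult.commute)
    then show False
      using order_preserved [OF V(4) fat(1,2) V(6) q(1-4)] order_preserved [OF V(5) fat(2,3) V(7) q(3-6)]
      by (intro ordered_triple_False [OF fat, of "2 * m" q1 q2 q3]) (use q \<open>m \<ge> 1\<close> in auto)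
  qed
  define V where "V i = (f ^^ N) ` (if i = 1 then U\<^sub>1 else if i = 2 then U\<^sub>2 else U\<^sub>3)" for i :: nat
  have V: "P (V 1)" "P (V 2)" "P (V 3)" using P123 by (simp_all add: V_def)
  have novV: "nonoverlapping (V 1) (V 2)" "nonoverlapping (V 2) (V 3)" "nonoverlapping (V 1) (V 3)"
    using nov by (simp_all add: V_def nonoverlapping_iterate)
  have cases: "precedes (V i) (V j) \<or> precedes (V j) (V i)"
    if "nonoverlapping (V i) (V j)" "P (V i)" "P (V j)" for i j
    using nonoverlapping_cases [OF that(1), of 0] that(2,3) by (simp add: P_def)
  note c = cases [OF novV(1) V(1,2)] cases [OF novV(2) V(2,3)] cases [OF novV(3) V(1,3)]
  note sym = novV [THEN nonoverlapping_sym]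
  \<comment> \<open>Whatever the three pairwise orders are, two of them form a chain; the six
    instances of \<open>ordered\<close> cover all chains.\<close>
  from c show False
    using ordered [OF V(1,2,3) novV(1,2)] ordered [OF V(1,3,2) novV(3) sym(2)]
      ordered [OF V(2,1,3) sym(1) novV(3)] ordered [OF V(2,3,1) novV(2) sym(3)]
      ordered [OF V(3,1,2) sym(3) novV(1)] ordered [OF V(3,2,1) sym(2,1)] by blast
qed

end

section \<open>Common images of finitely many fat sets and linked finite sets\<close>

definition outside :: "real \<Rightarrow> real \<Rightarrow> real \<Rightarrow> bool" where
  "outside z x y \<longleftrightarrow> z \<le> min x y \<or> max x y \<le> z"

text \<open>For a net of small intervals the two conditions bound the two one-sided excesses in the
  Hausdorff distance.\<close>

definition transversal :: "real set \<Rightarrow> real set set \<Rightarrow> bool" where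
  "transversal P \<S> \<longleftrightarrow> P \<subseteq> \<Union>\<S> \<and> (\<forall>S\<in>\<S>. S \<inter> P \<noteq> {})"

context chaotic_interval_map
begin

lemma obtain_overlap:
  assumes "\<not> nonoverlapping U V"
  obtains n W where "fat W" "W \<subseteq> (f ^^ n) ` U" "W \<subseteq> (f ^^ n) ` V"
  using assms unfolding nonoverlapping_def by (meson Int_lower1 Int_lower2)

text \<open>\<open>U\<close> and \<open>V\<close> may coincide, which is the case of a single
  target.\<close>

definition image_cover :: "real set set \<Rightarrow> nat \<Rightarrow> real set \<Rightarrow> real set \<Rightarrow> bool" where
  "image_cover \<J> N U V \<longleftrightarrow> fat U \<and> fat V \<and> (\<forall>J\<in>\<J>. U \<subseteq> (f ^^ N) ` J \<or> V \<subseteq> (f ^^ N) ` J)"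

text \<open>This is the passage to a later time: \<open>n\<close> further steps are made and the
  targets are shrunk or merged.\<close>

lemma image_cover_mono:
  assumes "image_cover \<J> N U V" "fat U'" "fat V'"
    and "U' \<subseteq> (f ^^ n) ` U \<or> V' \<subseteq> (f ^^ n) ` U" "U' \<subseteq> (f ^^ n) ` V \<or> V' \<subseteq> (f ^^ n) ` V"
  shows "image_cover \<J> (n + N) U' V'"
  unfolding image_cover_def
proof (intro conjI ballI assms)
  fix J assume "J \<in> \<J>"
  then have "U \<subseteq> (f ^^ N) ` J \<or> V \<subseteq> (f ^^ N) ` J" using assms(1) by (simp add: image_cover_def)
  then have "(f ^^ n) ` U \<subseteq> (f ^^ (n + N)) ` J \<or> (f ^^ n) ` V \<subseteq> (f ^^ (n + N)) ` J"
    unfolding iterate_image_add by (meson image_mono)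
  then show "U' \<subseteq> (f ^^ (n + N)) ` J \<or> V' \<subseteq> (f ^^ (n + N)) ` J"
    using assms(4,5) by (meson order_trans)
qed

text \<open>Induction on the family: among \<open>U\<close>, \<open>V\<close> and the image
  \<open>X\<close> of the new set, two overlap at some later time. Their overlap and the image of
  the third set are the new targets.\<close>

lemma exists_image_cover:
  assumes "finite \<J>" "\<And>J. J \<in> \<J> \<Longrightarrow> fat J"
  shows "\<exists>N U V. image_cover \<J> N U V"
  using assms
proof (induction \<J> rule: finite_induct)
  case empty
  have "fat {0..1}" by (rule fat_Icc) auto
  then show ?case by (auto simp: image_cover_def)
next
  case (insert J \<J>)
  then obtain N U V where cov: "image_cover \<J> N U V" by (meson insertI2)
  then have UV: "fat U" "fat V" by (simp_all add: image_cover_def)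
  define X where "X = (f ^^ N) ` J"
  have X: "fat X" unfolding X_def by (rule fat_iterate) (simp add: insert)
  have step: ?case
    if "fat U'" "fat V'" "U' \<subseteq> (f ^^ n) ` U \<or> V' \<subseteq> (f ^^ n) ` U"
      "U' \<subseteq> (f ^^ n) ` V \<or> V' \<subseteq> (f ^^ n) ` V" "U' \<subseteq> (f ^^ n) ` X \<or> V' \<subseteq> (f ^^ n) ` X" for U' V' n
  proof -
    have "image_cover \<J> (n + N) U' V'" by (rule image_cover_mono [OF cov that(1-4)])
    then have "image_cover (insert J \<J>) (n + N) U' V'"
      using that(5) by (simp add: image_cover_def X_def iterate_image_add)
    then show ?thesis by blast
  qed
  consider "\<not> nonoverlapping U V" | "\<not> nonoverlapping U X" | "\<not> nonoverlapping V X"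
    using no_nonoverlapping_triple [OF UV X] by blast
  then show ?case
  proof cases
    case 1
    then obtain n W where "fat W" "W \<subseteq> (f ^^ n) ` U" "W \<subseteq> (f ^^ n) ` V" by (rule obtain_overlap)
    then show ?thesis using step [of W "(f ^^ n) ` X" n] fat_iterate [OF X] by blast
  next
    case 2
    then obtain n W where "fat W" "W \<subseteq> (f ^^ n) ` U" "W \<subseteq> (f ^^ n) ` X" by (rule obtain_overlap)
    then show ?thesis using step [of W "(f ^^ n) ` V" n] fat_iterate [OF UV(2)] by blast
  next
    case 3
    then obtain n W where "fat W" "W \<subseteq> (f ^^ n) ` V" "W \<subseteq> (f ^^ n) ` X" by (rule obtain_overlap)
    then show ?thesis using step [of W "(f ^^ n) ` U" n] fat_iterate [OF UV(1)] by blast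
  qed
qed

lemma exists_reduced_image_cover:
  assumes "finite \<J>" "\<And>J. J \<in> \<J> \<Longrightarrow> fat J"
  shows "\<exists>N U V. image_cover \<J> N U V \<and> (U = V \<or> nonoverlapping U V)"
proof -
  obtain N U V where cov: "image_cover \<J> N U V" using exists_image_cover [OF assms] by blast
  show ?thesis
  proof (cases "nonoverlapping U V")
    case False
    then obtain n W where "fat W" "W \<subseteq> (f ^^ n) ` U" "W \<subseteq> (f ^^ n) ` V" by (rule obtain_overlap)
    then have "image_cover \<J> (n + N) W W" using image_cover_mono [OF cov] by blast
    then show ?thesis by blast
  qed (use cov in blast)
qed

text \<open>\<open>Z\<close> is empty or \<open>{z}\<close>, so both sets have at most two points.
  The position of \<open>z\<close> at all times ensures that it never shortens the Hausdorff
  distance below that of the orbits of \<open>x\<close> and \<open>y\<close>.\<close>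

definition linked :: "real set \<Rightarrow> real set \<Rightarrow> bool" where
  "linked P Q \<longleftrightarrow> (\<exists>x y z Z. P = insert x Z \<and> Q = insert y Z \<and> Z \<subseteq> {z} \<and> chaotic x y \<and>
     (\<forall>n. outside ((f ^^ n) z) ((f ^^ n) x) ((f ^^ n) y)))"

lemma linkedI:
  assumes "chaotic x y" "\<And>n. outside ((f ^^ n) z) ((f ^^ n) x) ((f ^^ n) y)" "Z \<subseteq> {z}"
  shows "linked (insert x Z) (insert y Z)"
  using assms unfolding linked_def by blast

lemma linked_sym:
  assumes "linked P Q" shows "linked Q P"
proof -
  obtain x y z Z where "P = insert x Z" "Q = insert y Z" "Z \<subseteq> {z}" "chaotic x y"
    "\<And>n. outside ((f ^^ n) z) ((f ^^ n) x) ((f ^^ n) y)"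
    using assms unfolding linked_def by blast
  moreover from this have "chaotic y x" by (simp add: chaotic_def abs_minus_commute)
  ultimately show ?thesis by (auto simp: outside_def min.commute max.commute intro!: linkedI [of y x z Z])
qed

text \<open>With \<open>x\<close> in \<open>S\<close> and \<open>y\<close> in \<open>T\<close>, the
  only possible defect is that the second set must also meet \<open>S\<close>. Then \<open>x\<close>
  itself serves as the shared point, which is trivially outside.\<close>

lemma linked_transversals_asym:
  assumes "fat S" "fat T" and A: "\<A> = {S}" and B: "\<B> \<subseteq> {S, T}" "T \<in> \<B>"
  shows "\<exists>P Q. linked P Q \<and> transversal P \<A> \<and> transversal Q \<B>"
proof -
  obtain x y where xy: "x \<in> S" "y \<in> T" "chaotic x y" using obtain_chaotic assms by metis
  define Z where "Z = (if S \<in> \<B> then {x} else {})"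
  have "linked (insert x Z) (insert y Z)"
    by (rule linkedI [OF xy(3), of x]) (auto simp: Z_def outside_def min_def max_def)
  moreover have "transversal (insert x Z) \<A>" "transversal (insert y Z) \<B>"
    using xy A B by (auto simp: transversal_def Z_def)
  ultimately show ?thesis by blast
qed

lemma linked_transversals:
  assumes fat: "fat U" "fat V" and UV: "U = V \<or> nonoverlapping U V"
    and A: "\<A> \<subseteq> {U, V}" "\<A> \<noteq> {}" and B: "\<B> \<subseteq> {U, V}" "\<B> \<noteq> {}"
  shows "\<exists>P Q. linked P Q \<and> transversal P \<A> \<and> transversal Q \<B>"
proof -
  have pair: ?thesis if "\<A> = {S}" "\<B> = {S}" "fat S" for S
    using linked_transversals_asym [OF that(3,3,1)] that(2) by simp
  have sub: "\<S> = {U} \<or> \<S> = {V} \<or> \<S> = {U, V}" if "\<S> \<subseteq> {U, V}" "\<S> \<noteq> {}" for \<S>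
    using that by blast
  consider S where "\<A> = {S}" "\<B> = {S}" "fat S"
    | S T where "fat S" "fat T" "\<A> = {S}" "\<B> \<subseteq> {S, T}" "T \<in> \<B>"
    | S T where "fat S" "fat T" "\<B> = {S}" "\<A> \<subseteq> {S, T}" "T \<in> \<A>"
    | "U \<noteq> V" "\<A> = {U, V}" "\<B> = {U, V}"
  proof (cases "U = V")
    case True
    then show thesis using that(1) [of U] sub [OF A] sub [OF B] fat(1) by simp
  next
    case False
    note c = that
    from sub [OF A] sub [OF B] show thesis
    proof (elim disjE)
      assume "\<A> = {U, V}" "\<B> = {U, V}" with False show thesis by (rule c(4))
    qed (rule c(1) c(2) [of U V] c(2) [of V U] c(3) [of U V] c(3) [of V U]; use fat in \<open>simp; fail\<close>)+
  qed
  then show ?thesis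
  proof cases
    case 1 then show ?thesis by (rule pair)
  next
    case 2 then show ?thesis by (rule linked_transversals_asym)
  next
    case 3
    then obtain P Q where "linked Q P" "transversal Q \<B>" "transversal P \<A>"
      using linked_transversals_asym [of S T \<B> \<A>] by blast
    then show ?thesis using linked_sym by blast
  next
    case 4
    \<comment> \<open>Both finite sets must meet \<open>U\<close> and \<open>V\<close>. The chaotic
      pair is taken in \<open>U\<close> and the shared point in \<open>V\<close>; at each time the
      image of \<open>V\<close> lies entirely on one side of the image of \<open>U\<close>.\<close>
    obtain x y where xy: "x \<in> U" "y \<in> U" "chaotic x y" using obtain_chaotic fat by metis
    obtain z where z: "z \<in> V" using fat_nonempty [OF fat(2)] by blast
    have "outside ((f ^^ n) z) ((f ^^ n) x) ((f ^^ n) y)" for n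
    proof -
      have "nonoverlapping U V" using UV 4 by blast
      then show ?thesis
        using nonoverlapping_cases [OF _ fat, of n] xy z by (auto simp: outside_def precedes_def)
    qed
    then have "linked (insert x {z}) (insert y {z})" by (intro linkedI [OF xy(3)]) auto
    moreover have "transversal (insert x {z}) \<A>" "transversal (insert y {z}) \<B>"
      using xy z 4 by (auto simp: transversal_def)
    ultimately show ?thesis by blast
  qed
qed

text \<open>Two kinds of preimages are collected: \<open>g\<close> picks one in each
  \<open>J\<close>, so that every \<open>J\<close> is met, and \<open>h\<close> picks one for each
  point of \<open>P\<close>, so that the image is all of \<open>P\<close>.\<close>

lemma transversal_lift:
  assumes "finite \<J>" "finite P" and P: "P \<subseteq> \<Union>\<S>" "\<And>S. S \<in> \<S> \<Longrightarrow> S \<inter> P \<noteq> {}"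
    and sub: "\<And>S. S \<in> \<S> \<Longrightarrow> \<exists>J\<in>\<J>. S \<subseteq> (f ^^ N) ` J"
    and cov: "\<And>J. J \<in> \<J> \<Longrightarrow> \<exists>S\<in>\<S>. S \<subseteq> (f ^^ N) ` J"
  shows "\<exists>A. finite A \<and> transversal A \<J> \<and> (f ^^ N) ` A = P"
proof -
  have "\<forall>J\<in>\<J>. \<exists>a. a \<in> J \<and> (f ^^ N) a \<in> P"
  proof
    fix J assume "J \<in> \<J>"
    then obtain S where S: "S \<in> \<S>" "S \<subseteq> (f ^^ N) ` J" using cov by blast
    obtain p where "p \<in> S" "p \<in> P" using P(2) [OF S(1)] by blast
    with S(2) show "\<exists>a. a \<in> J \<and> (f ^^ N) a \<in> P" by blast
  qed
  from bchoice [OF this] obtain g where g: "\<forall>J\<in>\<J>. g J \<in> J \<and> (f ^^ N) (g J) \<in> P" ..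
  have "\<forall>p\<in>P. \<exists>a. a \<in> \<Union>\<J> \<and> (f ^^ N) a = p"
  proof
    fix p assume "p \<in> P"
    then obtain S where S: "S \<in> \<S>" "p \<in> S" using P(1) by blast
    obtain J where "J \<in> \<J>" "S \<subseteq> (f ^^ N) ` J" using sub [OF S(1)] by blast
    with S(2) show "\<exists>a. a \<in> \<Union>\<J> \<and> (f ^^ N) a = p" by blast
  qed
  from bchoice [OF this] obtain h where h: "\<forall>p\<in>P. h p \<in> \<Union>\<J> \<and> (f ^^ N) (h p) = p" ..
  have "(f ^^ N) ` (g ` \<J> \<union> h ` P) = P"
    using g h by (auto simp: image_Un image_image)
  moreover have "transversal (g ` \<J> \<union> h ` P) \<J>" using g h by (auto simp: transversal_def)
  moreover have "finite (g ` \<J> \<union> h ` P)" using assms(1,2) by simp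
  ultimately show ?thesis by (intro exI conjI)
qed

lemma linked_finite: "linked P Q \<Longrightarrow> finite P \<and> finite Q"
  unfolding linked_def by (auto intro: finite_subset)

lemma exists_linked_iterate:
  assumes "finite \<A>" "\<A> \<noteq> {}" "\<And>J. J \<in> \<A> \<Longrightarrow> fat J"
    and "finite \<B>" "\<B> \<noteq> {}" "\<And>J. J \<in> \<B> \<Longrightarrow> fat J"
  shows "\<exists>A B N. finite A \<and> finite B \<and> transversal A \<A> \<and> transversal B \<B> \<and>
    linked ((f ^^ N) ` A) ((f ^^ N) ` B)"
proof -
  obtain N U V where cov: "image_cover (\<A> \<union> \<B>) N U V" and UV: "U = V \<or> nonoverlapping U V"
    using exists_reduced_image_cover [of "\<A> \<union> \<B>"] assms by blast
  \<comment> \<open>Only targets contained in the image of some member of \<open>\<J>\<close> are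
    kept, since points of other targets might have no preimage in the family.\<close>
  define \<S> where "\<S> \<J> = {S \<in> {U, V}. \<exists>J\<in>\<J>. S \<subseteq> (f ^^ N) ` J}" for \<J>
  have fat: "fat U" "fat V" using cov by (simp_all add: image_cover_def)
  have cov': "\<exists>S\<in>{U, V}. S \<subseteq> (f ^^ N) ` J" if "J \<in> \<A> \<union> \<B>" for J
    using cov that by (simp add: image_cover_def)
  have ne: "\<S> \<J> \<noteq> {}" if \<J>: "\<J> \<noteq> {}" "\<J> \<subseteq> \<A> \<union> \<B>" for \<J>
  proof -
    obtain J where "J \<in> \<J>" using \<J>(1) by blast
    with cov' [of J] \<J>(2) show ?thesis by (auto simp: \<S>_def)
  qed
  have "\<S> \<A> \<noteq> {}" "\<S> \<B> \<noteq> {}" using ne assms(2,5) by simp_all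
  moreover have "\<S> \<A> \<subseteq> {U, V}" "\<S> \<B> \<subseteq> {U, V}" by (auto simp: \<S>_def)
  ultimately obtain P Q where PQ: "linked P Q" "transversal P (\<S> \<A>)" "transversal Q (\<S> \<B>)"
    using linked_transversals [OF fat UV] by blast
  have fin: "finite P" "finite Q" using linked_finite [OF PQ(1)] by auto
  have lift: "\<exists>A. finite A \<and> transversal A \<J> \<and> (f ^^ N) ` A = P"
    if "finite \<J>" "finite P" "transversal P (\<S> \<J>)" "\<J> \<subseteq> \<A> \<union> \<B>" for \<J> P
  proof (rule transversal_lift [OF that(1,2)])
    show "P \<subseteq> \<Union>(\<S> \<J>)" "\<And>S. S \<in> \<S> \<J> \<Longrightarrow> S \<inter> P \<noteq> {}"
      using that(3) by (simp_all add: transversal_def)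
    show "\<exists>J\<in>\<J>. S \<subseteq> (f ^^ N) ` J" if "S \<in> \<S> \<J>" for S
      using that by (simp add: \<S>_def)
    show "\<exists>S\<in>\<S> \<J>. S \<subseteq> (f ^^ N) ` J" if "J \<in> \<J>" for J
      using cov' [of J] that \<open>\<J> \<subseteq> \<A> \<union> \<B>\<close> by (auto simp: \<S>_def)
  qed
  obtain A where "finite A" "transversal A \<A>" "(f ^^ N) ` A = P"
    using lift [OF assms(1) fin(1) PQ(2)] by auto
  moreover obtain B where "finite B" "transversal B \<B>" "(f ^^ N) ` B = Q"
    using lift [OF assms(4) fin(2) PQ(3)] by auto
  ultimately show ?thesis using PQ(1) by (intro exI [of _ A] exI [of _ B] exI [of _ N] conjI) simp_all
qed

end

section \<open>Approximation in the hyperspace\<close>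

text \<open>Products of balls form a base of the product topology, and the smaller radius serves
  both coordinates.\<close>

lemma densely_chaotic_iff:
  "densely_chaotic m g \<epsilon> \<longleftrightarrow> (\<forall>x\<in>mspace m. \<forall>y\<in>mspace m. \<forall>r>0.
     \<exists>u v. (u, v) \<in> chaotic_pairs m g \<epsilon> \<and> mdist m x u < r \<and> mdist m y v < r)"
    (is "_ \<longleftrightarrow> ?approx")
proof -
  interpret Metric_space "mspace m" "mdist m" by simp
  let ?X = "prod_topology (mtopology_of m) (mtopology_of m)" and ?C = "chaotic_pairs m g \<epsilon>"
  have sub: "?C \<subseteq> mspace m \<times> mspace m" by (auto simp: chaotic_pairs_def)
  have "?approx \<longleftrightarrow> mspace m \<times> mspace m \<subseteq> ?X closure_of ?C"
  proof
    assume approx: ?approx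
    show "mspace m \<times> mspace m \<subseteq> ?X closure_of ?C"
    proof (clarsimp simp: in_closure_of)
      fix x y T assume xy: "x \<in> mspace m" "y \<in> mspace m" and T: "(x, y) \<in> T" "openin ?X T"
      obtain U V where UV: "openin mtopology U" "openin mtopology V" "x \<in> U" "y \<in> V" "U \<times> V \<subseteq> T"
        using T unfolding openin_prod_topology_alt mtopology_of_def by meson
      obtain r s where r: "r > 0" "mball x r \<subseteq> U" and s: "s > 0" "mball y s \<subseteq> V"
        using UV by (meson openin_mtopology)
      obtain u v where uv: "(u, v) \<in> ?C" "mdist m x u < min r s" "mdist m y v < min r s"
        using approx xy r(1) s(1) by (metis min_less_iff_conj)
      then have "u \<in> mball x r" "v \<in> mball y s" using sub xy by auto
      with uv(1) r(2) s(2) UV(5) show "\<exists>a b. (a, b) \<in> ?C \<and> (a, b) \<in> T" by blast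
    qed
  next
    assume dense: "mspace m \<times> mspace m \<subseteq> ?X closure_of ?C"
    show ?approx
    proof (intro ballI allI impI)
      fix x y and r :: real assume xy: "x \<in> mspace m" "y \<in> mspace m" and "r > 0"
      have "openin ?X (mball x r \<times> mball y r)"
        by (simp add: openin_prod_Times_iff mtopology_of_def)
      moreover have "(x, y) \<in> mball x r \<times> mball y r" using xy \<open>r > 0\<close> by simp
      moreover have "(x, y) \<in> ?X closure_of ?C" using dense xy by blast
      ultimately obtain p where "p \<in> ?C" "p \<in> mball x r \<times> mball y r"
        by (metis (no_types, lifting) in_closure_of)
      then show "\<exists>u v. (u, v) \<in> ?C \<and> mdist m x u < r \<and> mdist m y v < r" by (cases p) auto
    qed
  qed
  moreover have "?X closure_of ?C \<subseteq> mspace m \<times> mspace m"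
    using closure_of_subset_topspace [of ?X ?C] by simp
  ultimately show ?thesis unfolding densely_chaotic_def by blast
qed

section \<open>Hausdorff distances of finite sets\<close>

lemma hausdorff_dist_le:
  assumes "A \<in> hyperspace m" "B \<in> hyperspace m"
    and "\<And>a. a \<in> A \<Longrightarrow> \<exists>b\<in>B. mdist m a b \<le> \<delta>" "\<And>b. b \<in> B \<Longrightarrow> \<exists>a\<in>A. mdist m a b \<le> \<delta>"
  shows "hausdorff_dist m A B \<le> \<delta>"
proof -
  have "(INF b\<in>B. mdist m a b) \<le> \<delta>" if "a \<in> A" for a
  proof -
    obtain b where b: "b \<in> B" "mdist m a b \<le> \<delta>" using assms(3) \<open>a \<in> A\<close> by blast
    show ?thesis using hausdorff_inf_le [OF b(1), of m a] b(2) by simp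
  qed
  then have "(SUP a\<in>A. INF b\<in>B. mdist m a b) \<le> \<delta>"
    by (intro cSUP_least hyperspaceD(1) [OF assms(1)])
  moreover have "(INF a\<in>A. mdist m a b) \<le> \<delta>" if "b \<in> B" for b
  proof -
    obtain a where a: "a \<in> A" "mdist m a b \<le> \<delta>" using assms(4) \<open>b \<in> B\<close> by blast
    show ?thesis using hausdorff_inf_le [OF a(1), of m b] a(2) by (simp add: mdist_commute)
  qed
  then have "(SUP b\<in>B. INF a\<in>A. mdist m a b) \<le> \<delta>"
    by (intro cSUP_least hyperspaceD(1) [OF assms(2)])
  ultimately show ?thesis using assms(1,2) by (simp add: hausdorff_dist_def)
qed

lemma hausdorff_dist_commute: "hausdorff_dist m A B = hausdorff_dist m B A"
  by (rule Metric_space.commute [OF Metric_space_hyperspace])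

lemma hausdorff_dist_ge:
  assumes "A \<in> hyperspace m" "B \<in> hyperspace m" "a \<in> A" "\<And>b. b \<in> B \<Longrightarrow> \<delta> \<le> mdist m a b"
  shows "\<delta> \<le> hausdorff_dist m A B"
proof -
  have "\<delta> \<le> (INF b\<in>B. mdist m a b)"
    by (intro cINF_greatest hyperspaceD(1) [OF assms(2)] assms(4))
  also have "\<dots> \<le> (SUP a\<in>A. INF b\<in>B. mdist m a b)" by (rule hausdorff_excess_le [OF assms(1-3)])
  finally show ?thesis using assms(1,2) by (simp add: hausdorff_dist_def)
qed

lemma finite_in_hyperspace:
  assumes "finite A" "A \<noteq> {}" "A \<subseteq> mspace m"
  shows "A \<in> hyperspace m"
  using assms by (simp add: hyperspace_def finite_imp_compactin)

lemma hausdorff_dist_insert_outside: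
  assumes "x \<in> {0..1}" "y \<in> {0..1}" "Z \<subseteq> {0..1}" "Z \<subseteq> {z}" and out: "z \<le> min x y \<or> max x y \<le> z"
  shows "hausdorff_dist unit_interval_metric (insert x Z) (insert y Z) = \<bar>x - y\<bar>"
proof (rule antisym)
  let ?m = unit_interval_metric
  have fin: "finite Z" using assms(4) by (rule finite_subset) simp
  have H: "insert x Z \<in> hyperspace ?m" "insert y Z \<in> hyperspace ?m"
    using assms fin by (auto intro!: finite_in_hyperspace)
  \<comment> \<open>For the upper bound \<open>x\<close> is matched with \<open>y\<close> and each
    point of \<open>Z\<close> with itself.\<close>
  show "hausdorff_dist ?m (insert x Z) (insert y Z) \<le> \<bar>x - y\<bar>"
    by (rule hausdorff_dist_le [OF H]) force+
  \<comment> \<open>The one of \<open>x\<close>, \<open>y\<close> that is farther from \<open>z\<close> realises the distance.\<close>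
  have "\<bar>x - y\<bar> \<le> \<bar>x - z\<bar> \<or> \<bar>x - y\<bar> \<le> \<bar>y - z\<bar>" using out by linarith
  then have "(\<forall>b\<in>insert y Z. \<bar>x - y\<bar> \<le> \<bar>x - b\<bar>) \<or> (\<forall>b\<in>insert x Z. \<bar>x - y\<bar> \<le> \<bar>y - b\<bar>)"
    using assms(4) by (auto simp: abs_minus_commute)
  then show "\<bar>x - y\<bar> \<le> hausdorff_dist ?m (insert x Z) (insert y Z)"
  proof
    assume "\<forall>b\<in>insert y Z. \<bar>x - y\<bar> \<le> \<bar>x - b\<bar>"
    then show ?thesis by (intro hausdorff_dist_ge [OF H, of x]) auto
  next
    assume "\<forall>b\<in>insert x Z. \<bar>x - y\<bar> \<le> \<bar>y - b\<bar>"
    then have "\<bar>x - y\<bar> \<le> hausdorff_dist ?m (insert y Z) (insert x Z)"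
      by (intro hausdorff_dist_ge [OF H(2,1), of y]) auto
    then show ?thesis by (simp add: hausdorff_dist_commute)
  qed
qed

lemma funpow_image:
  fixes f :: "'a \<Rightarrow> 'a"
  shows "((\<lambda>K. f ` K) ^^ n) A = (f ^^ n) ` A"
  by (induction n) (simp_all add: image_comp)

lemma exists_fat_net:
  assumes A: "A \<in> hyperspace unit_interval_metric" and "r > 0"
  shows "\<exists>\<J>. finite \<J> \<and> \<J> \<noteq> {} \<and> (\<forall>J\<in>\<J>. fat J) \<and>
    (\<forall>B. finite B \<longrightarrow> transversal B \<J> \<longrightarrow>
      B \<in> hyperspace unit_interval_metric \<and> hausdorff_dist unit_interval_metric A B < r)"
proof -
  let ?m = unit_interval_metric
  interpret Metric_space "mspace ?m" "mdist ?m" by (rule Metric_space_mspace_mdist)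
  \<comment> \<open>The net and the intervals contribute \<open>s\<close> each, and a third of
    \<open>r\<close> leaves room for the strict inequality.\<close>
  define s where "s = r / 3"
  have "s > 0" using assms(2) by (simp add: s_def)
  note AD = hyperspaceD [OF A]
  have "mtotally_bounded A"
    using AD(3) by (intro compactin_imp_mtotally_bounded) (simp add: mtopology_of_def)
  then obtain F where F: "finite F" "F \<subseteq> A" "A \<subseteq> (\<Union>x\<in>F. mball x s)"
    using \<open>s > 0\<close> unfolding mtotally_bounded_def by meson
  \<comment> \<open>Clipping to the unit interval leaves these sets fat, because their centres lie
    in it.\<close>
  define I where "I a = {max 0 (a - s)..min 1 (a + s)}" for a
  have AI: "A \<subseteq> {0..1}" using AD(2) by simp
  have IF: "I a \<subseteq> {0..1}" "x \<in> I a \<Longrightarrow> \<bar>a - x\<bar> \<le> s" for a x by (auto simp: I_def)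
  show ?thesis
  proof (intro exI [of _ "I ` F"] conjI ballI allI impI)
    show "finite (I ` F)" using F by simp
    show "I ` F \<noteq> {}" using F(3) AD(1) by auto
  next
    fix J assume "J \<in> I ` F"
    then obtain a where a: "a \<in> F" "J = I a" by blast
    then have "a \<in> {0..1}" using F(2) AI by blast
    then show "fat J" unfolding a(2) I_def using \<open>s > 0\<close> by (intro fat_Icc) auto
  next
    fix B assume "finite B" "transversal B (I ` F)"
    then have B: "finite B" "B \<subseteq> \<Union> (I ` F)" and meets: "\<And>c. c \<in> F \<Longrightarrow> I c \<inter> B \<noteq> {}"
      by (auto simp: transversal_def)
    have "F \<noteq> {}" using F(3) AD(1) by auto
    then have "B \<noteq> {}" using meets by blast
    moreover have "B \<subseteq> {0..1}" using B(2) IF(1) by blast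
    ultimately have BH: "B \<in> hyperspace ?m" using B(1) by (intro finite_in_hyperspace) auto
    have "hausdorff_dist ?m A B \<le> 2 * s"
    proof (rule hausdorff_dist_le [OF A BH])
      fix a assume "a \<in> A"
      then obtain c where c: "c \<in> F" "a \<in> mball c s" using F(3) by blast
      then have ca: "\<bar>c - a\<bar> < s" unfolding in_mball by simp
      obtain b where b: "b \<in> I c" "b \<in> B" using meets [OF c(1)] by blast
      show "\<exists>b\<in>B. mdist ?m a b \<le> 2 * s"
        using IF(2) [OF b(1)] ca by (intro bexI [OF _ b(2)]) simp
    next
      fix b assume "b \<in> B"
      then obtain c where c: "c \<in> F" "b \<in> I c" using B(2) by blast
      show "\<exists>a\<in>A. mdist ?m a b \<le> 2 * s"
        using IF(2) [OF c(2)] c(1) F(2) \<open>s > 0\<close> by (intro bexI [of _ c]) auto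
    qed
    also have "2 * s < r" using assms(2) by (simp add: s_def)
    finally have "hausdorff_dist ?m A B < r" .
    then show "B \<in> hyperspace ?m" "hausdorff_dist ?m A B < r" using BH by simp_all
  qed
qed

context chaotic_interval_map
begin

text \<open>A sequence with a chaotic tail is itself chaotic, so it suffices to compute the
  Hausdorff distances from time \<open>N\<close> on, where the images are linked.\<close>

lemma chaotic_pair_of_linked:
  assumes "finite A" "finite B" "A \<noteq> {}" "B \<noteq> {}" "A \<subseteq> {0..1}" "B \<subseteq> {0..1}"
    and "linked ((f ^^ N) ` A) ((f ^^ N) ` B)"
  shows "(A, B) \<in> chaotic_pairs (hyperspace_metric unit_interval_metric) (\<lambda>K. f ` K) \<epsilon>"
proof -
  let ?m = unit_interval_metric
  define d where "d n = hausdorff_dist ?m ((f ^^ n) ` A) ((f ^^ n) ` B)" for n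
  obtain x y z Z where P: "(f ^^ N) ` A = insert x Z" and Q: "(f ^^ N) ` B = insert y Z"
    and Z: "Z \<subseteq> {z}" and "chaotic x y"
    and out: "\<And>n. outside ((f ^^ n) z) ((f ^^ n) x) ((f ^^ n) y)"
    using assms(7) unfolding linked_def by blast
  have "insert x Z \<subseteq> {0..1}" "insert y Z \<subseteq> {0..1}"
    unfolding P [symmetric] Q [symmetric] using assms(5,6) iterate_mem by blast+
  then have mem: "x \<in> {0..1}" "y \<in> {0..1}" "Z \<subseteq> {0..1}" by auto
  have "d (n + N) = \<bar>(f ^^ n) x - (f ^^ n) y\<bar>" for n
  proof -
    have "d (n + N) = hausdorff_dist ?m (insert ((f ^^ n) x) ((f ^^ n) ` Z)) (insert ((f ^^ n) y) ((f ^^ n) ` Z))"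
      by (simp only: d_def iterate_image_add P Q image_insert)
    also have "\<dots> = \<bar>(f ^^ n) x - (f ^^ n) y\<bar>"
    proof (rule hausdorff_dist_insert_outside)
      show "(f ^^ n) ` Z \<subseteq> {(f ^^ n) z}" using Z by blast
      show "(f ^^ n) ` Z \<subseteq> {0..1}" using mem(3) iterate_mem by blast
    qed (use mem iterate_mem out [of n, unfolded outside_def] in blast)+
    finally show ?thesis .
  qed
  then have "chaotic_seq \<epsilon> d"
    using \<open>chaotic x y\<close> unfolding chaotic_def by (intro chaotic_seq_shift [of \<epsilon> d N]) simp
  moreover have "0 \<le> d n" for n
    unfolding d_def by (rule Metric_space.nonneg [OF Metric_space_hyperspace])
  ultimately have "liminf (\<lambda>n. ereal (d n)) = 0 \<and> limsup (\<lambda>n. ereal (d n)) > ereal \<epsilon>"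
    using chaotic_seq_iff_liminf_limsup [of d \<epsilon>] by blast
  moreover have "A \<in> hyperspace ?m" "B \<in> hyperspace ?m"
    using assms by (auto intro!: finite_in_hyperspace)
  ultimately show ?thesis by (simp add: chaotic_pairs_def funpow_image d_def)
qed

end

theorem theorem4p4:
  fixes f :: "real \<Rightarrow> real" and \<epsilon> :: real
  assumes "\<epsilon> > 0"
    and "continuous_on {0..1} f"
    and "f ` {0..1} \<subseteq> {0..1}"
    and "densely_chaotic unit_interval_metric f \<epsilon>"
  shows "densely_chaotic (hyperspace_metric unit_interval_metric) (\<lambda>K. f ` K) \<epsilon>"
proof -
  let ?m = unit_interval_metric
  have dense: "\<exists>u\<in>U. \<exists>v\<in>V. chaotic_seq \<epsilon> (\<lambda>n. \<bar>(f ^^ n) u - (f ^^ n) v\<bar>)" if "fat U" "fat V" for U V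
  proof -
    obtain a b where U: "a \<in> U" "b \<in> U" "a < b" using \<open>fat U\<close> by (auto simp: fat_def)
    obtain c d where V: "c \<in> V" "d \<in> V" "c < d" using \<open>fat V\<close> by (auto simp: fat_def)
    \<comment> \<open>Balls of this radius around the midpoints stay inside \<open>{a..b}\<close>
      and \<open>{c..d}\<close>.\<close>
    define r where "r = min ((b - a) / 2) ((d - c) / 2)"
    have mem: "(a + b) / 2 \<in> {0..1}" "(c + d) / 2 \<in> {0..1}" "r > 0"
      using U V that by (auto simp: fat_def r_def)
    obtain u v where uv: "(u, v) \<in> chaotic_pairs ?m f \<epsilon>"
      "\<bar>(a + b) / 2 - u\<bar> < r" "\<bar>(c + d) / 2 - v\<bar> < r"
      using assms(4) mem unfolding densely_chaotic_iff mspace_unit_interval_metric mdist_unit_interval_metric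
      by meson
    have "u \<in> {a..b}" using uv(2) unfolding r_def min_less_iff_conj by (auto simp: abs_less_iff field_simps)
    moreover have "v \<in> {c..d}" using uv(3) unfolding r_def min_less_iff_conj by (auto simp: abs_less_iff field_simps)
    ultimately have "u \<in> U" "v \<in> V" using fat_Icc_subset that U V by blast+
    moreover have "chaotic_seq \<epsilon> (\<lambda>n. \<bar>(f ^^ n) u - (f ^^ n) v\<bar>)"
      using uv(1) by (simp add: chaotic_pairs_def flip: chaotic_seq_iff_liminf_limsup)
    ultimately show ?thesis by blast
  qed
  interpret chaotic_interval_map f \<epsilon> by unfold_locales (use assms dense in auto)
  show ?thesis
    unfolding densely_chaotic_iff mspace_hyperspace_metric mdist_hyperspace_metric
  proof (intro ballI allI impI)
    fix A B and r :: real
    assume A: "A \<in> hyperspace ?m" and B: "B \<in> hyperspace ?m" and "r > 0"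
    obtain \<A> where \<A>: "finite \<A>" "\<A> \<noteq> {}" "\<And>J. J \<in> \<A> \<Longrightarrow> fat J"
      and A_near: "\<And>C. finite C \<Longrightarrow> transversal C \<A> \<Longrightarrow> C \<in> hyperspace ?m \<and> hausdorff_dist ?m A C < r"
      using exists_fat_net [OF A \<open>r > 0\<close>] by meson
    obtain \<B> where \<B>: "finite \<B>" "\<B> \<noteq> {}" "\<And>J. J \<in> \<B> \<Longrightarrow> fat J"
      and B_near: "\<And>C. finite C \<Longrightarrow> transversal C \<B> \<Longrightarrow> C \<in> hyperspace ?m \<and> hausdorff_dist ?m B C < r"
      using exists_fat_net [OF B \<open>r > 0\<close>] by meson
    \<comment> \<open>Transversality to the nets keeps \<open>A'\<close> and \<open>B'\<close> near
      \<open>A\<close> and \<open>B\<close>, and the link between their images at time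
      \<open>N\<close> makes the pair chaotic.\<close>
    obtain A' B' N where fin: "finite A'" "finite B'" and "transversal A' \<A>" "transversal B' \<B>"
      and link: "linked ((f ^^ N) ` A') ((f ^^ N) ` B')"
      using exists_linked_iterate [OF \<A> \<B>] by meson
    then have A': "A' \<in> hyperspace ?m" "hausdorff_dist ?m A A' < r"
      and B': "B' \<in> hyperspace ?m" "hausdorff_dist ?m B B' < r"
      using A_near [of A'] B_near [of B'] by simp_all
    have "(A', B') \<in> chaotic_pairs (hyperspace_metric ?m) (\<lambda>K. f ` K) \<epsilon>"
      using hyperspaceD(1,2) [OF A'(1)] hyperspaceD(1,2) [OF B'(1)]
      by (intro chaotic_pair_of_linked [OF fin _ _ _ _ link]) auto
    then show "\<exists>u v. (u, v) \<in> chaotic_pairs (hyperspace_metric ?m) (\<lambda>K. f ` K) \<epsilon> \<and>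
        hausdorff_dist ?m A u < r \<and> hausdorff_dist ?m B v < r"
      using A'(2) B'(2) by blast
  qed
qed

end
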